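(* Let $k>0$ be a natural number. Let $\Sigma(S^1)$ be the spinor bundle associated to a fixed spin structure on the circle $S^1$. Then there exists a complex vector bundle $E\to S^1$ (equipped with a Hermitian metric and a metric connection) such that the kernel of the twisted Dirac operator $D$ on $E\otimes\Sigma(S^1)$ has dimension at least $k$.
   Context: $S^1$ is a closed Riemannian spin manifold. The twisted Dirac operator on $E\otimes\Sigma(S^1)$ is $D=c(e_1)\nabla_{e_1}$ acting on smooth sections of $E\otimes\Sigma(S^1)$, where $e_1$ is a (local) unit tangent vector field on $S^1$, $c$ is Clifford multiplication (acting on the factor $\Sigma(S^1)$), and $\nabla$ is the tensor product of the connection on $E$ and the spinor connection on $\Sigma(S^1)$. Dimension means complex dimension. *)

theory Defs
  imports "HOL-Analysis.Analysis" "HOL-Library.Function_Algebras"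
begin

section \<open>Smooth functions and tangent vectors on the circle\<close>

abbreviation S1 :: "complex set" where
  "S1 \<equiv> sphere 0 1"

abbreviation open_in_S1 :: "complex set \<Rightarrow> bool" where
  "open_in_S1 U \<equiv> openin (top_of_set S1) U"

text \<open>The derivative along the coordinate field, i.e. along the flow \<open>t \<mapsto> z * cis t\<close>.
  At a point of an open \<open>U\<close> it only depends on the restriction of the function to \<open>U\<close>.\<close>

definition angular_deriv :: "(complex \<Rightarrow> complex) \<Rightarrow> complex \<Rightarrow> complex" where
  "angular_deriv f z = vector_derivative (\<lambda>t::real. f (z * cis t)) (at 0)"

definition smooth_fun_on :: "complex set \<Rightarrow> (complex \<Rightarrow> complex) \<Rightarrow> bool" where
  "smooth_fun_on U f \<longleftrightarrow>
     (\<forall>n. \<forall>z\<in>U. (\<lambda>t::real. (angular_deriv ^^ n) f (z * cis t)) differentiable (at 0))"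

definition tangent_S1 :: "complex \<Rightarrow> complex set" where
  "tangent_S1 z = range (\<lambda>a::real. of_real a * (\<i> * z))"

definition tangent_coord :: "complex \<Rightarrow> complex \<Rightarrow> real" where
  "tangent_coord z v = Re (v / (\<i> * z))"

definition dir_deriv :: "(complex \<Rightarrow> complex) \<Rightarrow> complex \<Rightarrow> complex \<Rightarrow> complex" where
  "dir_deriv f z v = of_real (tangent_coord z v) * angular_deriv f z"

definition smooth_field_on :: "complex set \<Rightarrow> (complex \<Rightarrow> complex) \<Rightarrow> bool" where
  "smooth_field_on U X \<longleftrightarrow> (\<forall>z\<in>U. X z \<in> tangent_S1 z) \<and> smooth_fun_on U X"

type_synonym riem_metric = "complex \<Rightarrow> complex \<Rightarrow> complex \<Rightarrow> real"

definition riemannian_metric_S1 :: "riem_metric \<Rightarrow> bool" where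
  "riemannian_metric_S1 g \<longleftrightarrow>
     (\<forall>z\<in>S1. \<forall>u\<in>tangent_S1 z. \<forall>v\<in>tangent_S1 z. g z u v = g z v u) \<and>
     (\<forall>z\<in>S1. \<forall>u\<in>tangent_S1 z. \<forall>v\<in>tangent_S1 z. \<forall>w\<in>tangent_S1 z.
        g z (u + v) w = g z u w + g z v w) \<and>
     (\<forall>z\<in>S1. \<forall>u\<in>tangent_S1 z. \<forall>v\<in>tangent_S1 z. \<forall>a. g z (of_real a * u) v = a * g z u v) \<and>
     (\<forall>z\<in>S1. \<forall>v\<in>tangent_S1 z. v \<noteq> 0 \<longrightarrow> g z v v > 0) \<and>
     smooth_fun_on S1 (\<lambda>z. of_real (g z (\<i> * z) (\<i> * z)))"


section \<open>Spin structures\<close>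

text \<open>An orientation is a sign: \<open>1\<close> is the counterclockwise one, \<open>-1\<close> the clockwise one.
  The bundle of oriented orthonormal frames has structure group \<open>SO(1) = {1}\<close>.\<close>

definition oriented_frames :: "riem_metric \<Rightarrow> real \<Rightarrow> (complex \<times> complex) set" where
  "oriented_frames g ori =
     {(z, v). z \<in> S1 \<and> v \<in> tangent_S1 z \<and> g z v v = 1 \<and> ori * tangent_coord z v > 0}"

definition Spin1 :: "real set" where
  "Spin1 = {1, -1}"

record 'p spin_circle =
  riem :: riem_metric
  orient :: real
  spin_total :: "'p set"
  spin_act :: "'p \<Rightarrow> real \<Rightarrow> 'p"
  spin_cover :: "'p \<Rightarrow> complex \<times> complex"

definition base_point :: "'p spin_circle \<Rightarrow> 'p \<Rightarrow> complex" where
  "base_point M p = fst (spin_cover M p)"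

text \<open>A principal \<open>Spin(1)\<close>-bundle (with a right action) together with a covering map to the
  bundle of oriented orthonormal frames. Since \<open>Spin(1) \<rightarrow> SO(1)\<close> is trivial, equivariance of
  the covering map is invariance, and its fibres are the \<open>Spin(1)\<close>-orbits.\<close>

definition spin_structure :: "('p::topological_space) spin_circle \<Rightarrow> bool" where
  "spin_structure M \<longleftrightarrow>
     covering_space (spin_total M) (spin_cover M) (oriented_frames (riem M) (orient M)) \<and>
     (\<forall>a\<in>Spin1. continuous_on (spin_total M) (\<lambda>p. spin_act M p a) \<and>
        (\<lambda>p. spin_act M p a) ` spin_total M \<subseteq> spin_total M) \<and>
     (\<forall>p\<in>spin_total M. spin_act M p 1 = p) \<and>
     (\<forall>p\<in>spin_total M. \<forall>a\<in>Spin1. \<forall>b\<in>Spin1. spin_act M p (a * b) = spin_act M (spin_act M p a) b) \<and>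
     (\<forall>p\<in>spin_total M. \<forall>a\<in>Spin1. spin_cover M (spin_act M p a) = spin_cover M p) \<and>
     (\<forall>p\<in>spin_total M. \<forall>a\<in>Spin1. spin_act M p a = p \<longrightarrow> a = 1) \<and>
     (\<forall>p\<in>spin_total M. \<forall>q\<in>spin_total M. spin_cover M p = spin_cover M q \<longrightarrow>
        (\<exists>a\<in>Spin1. q = spin_act M p a))"

definition riemannian_spin_circle :: "('p::topological_space) spin_circle \<Rightarrow> bool" where
  "riemannian_spin_circle M \<longleftrightarrow>
     riemannian_metric_S1 (riem M) \<and> orient M \<in> {1, -1} \<and> spin_structure M"

definition local_spin_frame ::
    "('p::topological_space) spin_circle \<Rightarrow> complex set \<Rightarrow> (complex \<Rightarrow> 'p) \<Rightarrow> bool" where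
  "local_spin_frame M U q \<longleftrightarrow>
     open_in_S1 U \<and> continuous_on U q \<and> (\<forall>z\<in>U. q z \<in> spin_total M \<and> base_point M (q z) = z)"

definition unit_tangent :: "'p spin_circle \<Rightarrow> complex \<Rightarrow> complex" where
  "unit_tangent M z = (THE v. (z, v) \<in> oriented_frames (riem M) (orient M))"


section \<open>Complex vector bundles, Hermitian metrics, connections\<close>

definition scale_vec :: "complex \<Rightarrow> ('i \<Rightarrow> complex) \<Rightarrow> 'i \<Rightarrow> complex" where
  "scale_vec c v = (\<lambda>i. c * v i)"

definition scale_sec :: "complex \<Rightarrow> (complex \<Rightarrow> 'i \<Rightarrow> complex) \<Rightarrow> complex \<Rightarrow> 'i \<Rightarrow> complex" where
  "scale_sec c s = (\<lambda>z. scale_vec c (s z))"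

interpretation cvec: vector_space scale_vec
  by unfold_locales (auto simp: scale_vec_def fun_eq_iff algebra_simps)

interpretation csec: vector_space scale_sec
  by unfold_locales (auto simp: scale_sec_def scale_vec_def fun_eq_iff algebra_simps)

text \<open>A bundle is given by a family of finite-dimensional complex vector spaces and a collection
  of local frames \<open>(U, e)\<close>, where \<open>e j z\<close> for \<open>j < rk\<close> is the \<open>j\<close>-th basis vector of the fibre
  over \<open>z \<in> U\<close>. The fibres are realised as linear subspaces of a space of functions
  \<open>'i \<Rightarrow> complex\<close>; this is only a device for having concrete vectors. The
  topology and the smooth structure of the bundle are those for which the given frames are smooth,
  and they are unrelated to the ambient space.\<close>

type_synonym 'i bsection = "complex \<Rightarrow> 'i \<Rightarrow> complex"
type_synonym 'i bframe = "nat \<Rightarrow> 'i bsection"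

record 'i vbundle =
  rk :: nat
  fibre :: "complex \<Rightarrow> ('i \<Rightarrow> complex) set"
  frames :: "(complex set \<times> 'i bframe) set"

definition basis_of :: "nat \<Rightarrow> (nat \<Rightarrow> 'i \<Rightarrow> complex) \<Rightarrow> ('i \<Rightarrow> complex) set \<Rightarrow> bool" where
  "basis_of r b V \<longleftrightarrow>
     inj_on b {..<r} \<and> cvec.independent (b ` {..<r}) \<and> cvec.span (b ` {..<r}) = V"

definition vector_bundle :: "'i vbundle \<Rightarrow> bool" where
  "vector_bundle E \<longleftrightarrow>
     (\<forall>z\<in>S1. \<exists>(U, e)\<in>frames E. z \<in> U) \<and>
     (\<forall>(U, e)\<in>frames E. open_in_S1 U \<and> (\<forall>z\<in>U. basis_of (rk E) (\<lambda>j. e j z) (fibre E z))) \<and>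
     (\<forall>(U, e)\<in>frames E. \<forall>(V, f)\<in>frames E. \<exists>a.
        (\<forall>i<rk E. \<forall>j<rk E. smooth_fun_on (U \<inter> V) (a i j)) \<and>
        (\<forall>z\<in>U \<inter> V. \<forall>j<rk E. f j z = (\<Sum>i<rk E. scale_vec (a i j z) (e i z))))"

definition smooth_section_on :: "'i vbundle \<Rightarrow> complex set \<Rightarrow> 'i bsection \<Rightarrow> bool" where
  "smooth_section_on E U s \<longleftrightarrow>
     (\<forall>z\<in>U. s z \<in> fibre E z) \<and>
     (\<forall>(V, e)\<in>frames E. \<exists>a.
        (\<forall>j<rk E. smooth_fun_on (U \<inter> V) (a j)) \<and>
        (\<forall>z\<in>U \<inter> V. s z = (\<Sum>j<rk E. scale_vec (a j z) (e j z))))"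

definition hermitian_metric ::
    "'i vbundle \<Rightarrow> (complex \<Rightarrow> ('i \<Rightarrow> complex) \<Rightarrow> ('i \<Rightarrow> complex) \<Rightarrow> complex) \<Rightarrow> bool" where
  "hermitian_metric E h \<longleftrightarrow>
     (\<forall>z\<in>S1. \<forall>u\<in>fibre E z. \<forall>v\<in>fibre E z. h z u v = cnj (h z v u)) \<and>
     (\<forall>z\<in>S1. \<forall>u\<in>fibre E z. \<forall>v\<in>fibre E z. \<forall>w\<in>fibre E z. h z (u + v) w = h z u w + h z v w) \<and>
     (\<forall>z\<in>S1. \<forall>u\<in>fibre E z. \<forall>v\<in>fibre E z. \<forall>c. h z (scale_vec c u) v = c * h z u v) \<and>
     (\<forall>z\<in>S1. \<forall>v\<in>fibre E z. v \<noteq> 0 \<longrightarrow> Re (h z v v) > 0) \<and>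
     (\<forall>U s t. open_in_S1 U \<longrightarrow> smooth_section_on E U s \<longrightarrow> smooth_section_on E U t \<longrightarrow>
        smooth_fun_on U (\<lambda>z. h z (s z) (t z)))"

text \<open>A connection acts on smooth local sections, compatibly with restriction; \<open>nab s z v\<close> is the
  derivative of \<open>s\<close> at \<open>z\<close> in the direction of the tangent vector \<open>v\<close>.\<close>

type_synonym 'i covariant_deriv = "'i bsection \<Rightarrow> complex \<Rightarrow> complex \<Rightarrow> 'i \<Rightarrow> complex"

definition connection :: "'i vbundle \<Rightarrow> 'i covariant_deriv \<Rightarrow> bool" where
  "connection E nab \<longleftrightarrow> (\<forall>U. open_in_S1 U \<longrightarrow>
     (\<forall>s. smooth_section_on E U s \<longrightarrow>
        (\<forall>t. (\<forall>z\<in>U. s z = t z) \<longrightarrow> (\<forall>z\<in>U. \<forall>v\<in>tangent_S1 z. nab s z v = nab t z v)) \<and>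
        (\<forall>X. smooth_field_on U X \<longrightarrow> smooth_section_on E U (\<lambda>z. nab s z (X z))) \<and>
        (\<forall>z\<in>U. \<forall>v\<in>tangent_S1 z. \<forall>w\<in>tangent_S1 z. nab s z (v + w) = nab s z v + nab s z w) \<and>
        (\<forall>z\<in>U. \<forall>v\<in>tangent_S1 z. \<forall>a::real.
           nab s z (of_real a * v) = scale_vec (of_real a) (nab s z v)) \<and>
        (\<forall>t. smooth_section_on E U t \<longrightarrow> (\<forall>z\<in>U. \<forall>v\<in>tangent_S1 z.
           nab (\<lambda>x. s x + t x) z v = nab s z v + nab t z v)) \<and>
        (\<forall>f. smooth_fun_on U f \<longrightarrow> (\<forall>z\<in>U. \<forall>v\<in>tangent_S1 z.
           nab (\<lambda>x. scale_vec (f x) (s x)) z v =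
             scale_vec (dir_deriv f z v) (s z) + scale_vec (f z) (nab s z v)))))"

definition metric_connection ::
    "'i vbundle \<Rightarrow> (complex \<Rightarrow> ('i \<Rightarrow> complex) \<Rightarrow> ('i \<Rightarrow> complex) \<Rightarrow> complex) \<Rightarrow>
     'i covariant_deriv \<Rightarrow> bool" where
  "metric_connection E h nab \<longleftrightarrow> connection E nab \<and>
     (\<forall>U s t. open_in_S1 U \<longrightarrow> smooth_section_on E U s \<longrightarrow> smooth_section_on E U t \<longrightarrow>
        (\<forall>z\<in>U. \<forall>v\<in>tangent_S1 z.
           dir_deriv (\<lambda>x. h x (s x) (t x)) z v = h z (nab s z v) (t z) + h z (s z) (nab t z v)))"


section \<open>Tensor products\<close>

definition tensor_vec :: "('i \<Rightarrow> complex) \<Rightarrow> ('j \<Rightarrow> complex) \<Rightarrow> 'i \<times> 'j \<Rightarrow> complex" where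
  "tensor_vec v w = (\<lambda>(i, j). v i * w j)"

text \<open>For linear subspaces \<open>V\<close> of \<open>'i \<Rightarrow> complex\<close> and \<open>W\<close> of \<open>'j \<Rightarrow> complex\<close> the canonical map
  from the tensor product of \<open>V\<close> and \<open>W\<close> to \<open>'i \<times> 'j \<Rightarrow> complex\<close> is injective; its image is the
  span of the decomposable tensors.\<close>

definition tensor_bundle :: "'i vbundle \<Rightarrow> 'j vbundle \<Rightarrow> ('i \<times> 'j) vbundle" where
  "tensor_bundle E F =
     \<lparr> rk = rk E * rk F,
       fibre = (\<lambda>z. cvec.span {tensor_vec v w | v w. v \<in> fibre E z \<and> w \<in> fibre F z}),
       frames = {(U \<inter> V, \<lambda>j z. tensor_vec (e (j div rk F) z) (f (j mod rk F) z)) | U e V f.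
                   (U, e) \<in> frames E \<and> (V, f) \<in> frames F} \<rparr>"

text \<open>Locally every smooth section is a finite sum of decomposable ones, so the product rule
  determines the tensor product connection.\<close>

definition tensor_connection ::
    "'i vbundle \<Rightarrow> 'i covariant_deriv \<Rightarrow> 'j vbundle \<Rightarrow> 'j covariant_deriv \<Rightarrow>
     ('i \<times> 'j) covariant_deriv" where
  "tensor_connection E nabE F nabF \<psi> z v =
     (THE y. \<exists>U n s t. open_in_S1 U \<and> z \<in> U \<and>
        (\<forall>l<n::nat. smooth_section_on E U (s l) \<and> smooth_section_on F U (t l)) \<and>
        (\<forall>x\<in>U. \<psi> x = (\<Sum>l<n. tensor_vec (s l x) (t l x))) \<and>
        y = (\<Sum>l<n. tensor_vec (nabE (s l) z v) (t l z) + tensor_vec (s l z) (nabF (t l) z v)))"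


section \<open>The spinor bundle and the twisted Dirac operator\<close>

text \<open>The spinor representation of \<open>Spin(1)\<close> on \<open>complex\<close> is multiplication. The class
  \<open>[p, w]\<close> in the associated bundle, where \<open>[p a, w] = [p, a w]\<close>, is represented by the
  equivariant function \<open>p a \<mapsto> inverse a * w\<close> on the orbit of \<open>p\<close>.\<close>

definition spinor :: "'p spin_circle \<Rightarrow> 'p \<Rightarrow> complex \<Rightarrow> 'p \<Rightarrow> complex" where
  "spinor M p w = (\<lambda>r. \<Sum>a\<in>Spin1. if r = spin_act M p a then of_real (inverse a) * w else 0)"

definition spinor_bundle :: "('p::topological_space) spin_circle \<Rightarrow> 'p vbundle" where
  "spinor_bundle M =
     \<lparr> rk = 1,
       fibre = (\<lambda>z. {spinor M p w | p w. p \<in> spin_total M \<and> base_point M p = z}),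
       frames = {(U, \<lambda>j z. spinor M (q z) 1) | U q. local_spin_frame M U q} \<rparr>"

text \<open>The connection induced by the Levi-Civita connection. In dimension one the connection form
  takes values in the zero Lie algebra, so sections \<open>[q, 1]\<close> with \<open>q\<close> a local spin frame are
  parallel. The coefficient of a section \<open>s\<close> with respect to \<open>[q, 1]\<close> is \<open>s x (q x)\<close>.\<close>

definition spinor_connection :: "('p::topological_space) spin_circle \<Rightarrow> 'p covariant_deriv" where
  "spinor_connection M s z v =
     (THE y. \<exists>U q. local_spin_frame M U q \<and> z \<in> U \<and>
        y = spinor M (q z) (dir_deriv (\<lambda>x. s x (q x)) z v))"

text \<open>The oriented unit vector acts as \<open>\<i>\<close>, so that its square is \<open>-1\<close>. The other irreducible
  Clifford module, with \<open>-\<i>\<close>, is obtained by reversing the orientation.\<close>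

definition clifford :: "'p spin_circle \<Rightarrow> complex \<Rightarrow> complex \<Rightarrow> ('p \<Rightarrow> complex) \<Rightarrow> 'p \<Rightarrow> complex" where
  "clifford M z v \<sigma> = scale_vec (\<i> * of_real (riem M z v (unit_tangent M z))) \<sigma>"

definition twisted_clifford ::
    "'p spin_circle \<Rightarrow> complex \<Rightarrow> complex \<Rightarrow> ('i \<times> 'p \<Rightarrow> complex) \<Rightarrow> 'i \<times> 'p \<Rightarrow> complex" where
  "twisted_clifford M z v \<phi> = (\<lambda>(i, p). clifford M z v (\<lambda>r. \<phi> (i, r)) p)"

definition twisted_spinor_bundle ::
    "('p::topological_space) spin_circle \<Rightarrow> 'i vbundle \<Rightarrow> ('i \<times> 'p) vbundle" where
  "twisted_spinor_bundle M E = tensor_bundle E (spinor_bundle M)"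

definition twisted_dirac ::
    "('p::topological_space) spin_circle \<Rightarrow> 'i vbundle \<Rightarrow> 'i covariant_deriv \<Rightarrow>
     ('i \<times> 'p) bsection \<Rightarrow> ('i \<times> 'p) bsection" where
  "twisted_dirac M E nab \<psi> z =
     twisted_clifford M z (unit_tangent M z)
       (tensor_connection E nab (spinor_bundle M) (spinor_connection M) \<psi> z (unit_tangent M z))"

text \<open>Sections are functions on all of \<open>complex\<close>; extending them by zero off the circle makes
  the representation unique.\<close>

definition dirac_kernel ::
    "('p::topological_space) spin_circle \<Rightarrow> 'i vbundle \<Rightarrow> 'i covariant_deriv \<Rightarrow>
     ('i \<times> 'p) bsection set" where
  "dirac_kernel M E nab =
     {\<psi>. smooth_section_on (twisted_spinor_bundle M E) S1 \<psi> \<and> (\<forall>z. z \<notin> S1 \<longrightarrow> \<psi> z = 0) \<and>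
          (\<forall>z\<in>S1. twisted_dirac M E nab \<psi> z = 0)}"

end

theory Submission
  imports Defs
begin

text \<open>The spinor bundle \<open>\<Sigma>\<close> of the circle is a flat line bundle with holonomy \<open>\<plusminus>1\<close>, so its tensor square
  is trivial as a flat bundle. Twisting by \<open>k\<close> copies of \<open>\<Sigma>\<close> itself therefore gives \<open>k\<close> independent
  parallel spinors for every spin structure. Conversely the Dirac operator on the twisted bundle is a
  nonzero multiple of the derivative in this trivialisation, so its kernel consists of the parallel
  spinors only. The latter matters because \<open>csec.dim\<close> is \<open>0\<close> on infinite-dimensional spaces.\<close>

section \<open>Calculus on the circle\<close>

text \<open>The obstacle is that the spin bundle need not have a global continuous section, while
  both spin structures are to be handled at once. So a spin frame \<open>rep z\<close> is picked at
  each point with no regard to continuity, and every spinor is described by its scalar coefficient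
  relative to \<open>base_spinor z\<close>. Such coefficients of smooth sections become smooth only
  after multiplication by a local sign, which compares a continuous spin frame with
  \<open>rep\<close>. A product of two such twisted functions is an honest smooth function, because
  the same sign occurs twice and squares to 1. This one fact yields the Hermitian metric, the
  globally smooth coefficients of twisted spinors and the Leibniz rule behind the tensor connection.
  The twisting bundle has fibres in functions on \<open>nat\<close> and not on \<open>'p\<close>, so
  the copies of the spinor bundle are rebuilt from the local signs. The connections are defined by
  descriptions and \<open>tderiv\<close> by a choice, so each needs an independence argument: of the
  spin frame, of the sign, of the decomposition into tensors.\<close>

definition has_angular_deriv :: "(complex \<Rightarrow> complex) \<Rightarrow> complex \<Rightarrow> complex \<Rightarrow> bool" where
  "has_angular_deriv f d z \<longleftrightarrow> ((\<lambda>t::real. f (z * cis t)) has_vector_derivative d) (at 0)"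

lemma angular_deriv_eqI: "has_angular_deriv f d z \<Longrightarrow> angular_deriv f z = d"
  unfolding has_angular_deriv_def angular_deriv_def by (rule vector_derivative_at)

lemma differentiable_iff_has_angular_deriv:
  "(\<lambda>t::real. f (z * cis t)) differentiable (at 0) \<longleftrightarrow> has_angular_deriv f (angular_deriv f z) z"
  unfolding has_angular_deriv_def angular_deriv_def by (rule vector_derivative_works)

text \<open>The flow never leaves the circle, so relative openness is enough. This is what makes all
  derivatives along the flow local.\<close>

lemma eventually_flow_in_open:
  assumes "open_in_S1 W" "z \<in> W"
  shows "\<forall>\<^sub>F t in nhds (0::real). z * cis t \<in> W"
proof -
  obtain O' where O': "open O'" "W = S1 \<inter> O'"
    using assms(1) by (auto simp: openin_open)
  have c: "isCont (\<lambda>t::real. z * cis t) 0"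
    unfolding cis_conv_exp by (intro continuous_intros)
  have "z * cis 0 \<in> O'" using assms O' by simp
  then have "\<forall>\<^sub>F t in nhds (0::real). z * cis t \<in> O'"
    using c O'(1) unfolding continuous_at tendsto_def eventually_at_filter
    by (auto elim!: allE[of _ O'] eventually_mono)
  then show ?thesis
    by (rule eventually_mono) (use assms O' in \<open>auto simp: norm_mult\<close>)
qed

lemma has_angular_deriv_cong:
  assumes "open_in_S1 W" "z \<in> W" "\<And>x. x \<in> W \<Longrightarrow> f x = g x"
  shows "has_angular_deriv f d z \<longleftrightarrow> has_angular_deriv g d z"
proof -
  have ev: "\<forall>\<^sub>F t in nhds (0::real). f (z * cis t) = g (z * cis t)"
    using eventually_flow_in_open[OF assms(1,2)] by (rule eventually_mono) (rule assms(3))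
  show ?thesis
    unfolding has_angular_deriv_def
    by (rule has_vector_derivative_cong_ev)
      (use ev assms in \<open>auto elim: eventually_mono\<close>)
qed

text \<open>\<open>vector_derivative\<close> is a choice from the set of derivatives, and that set
  is the same for \<open>f\<close> and \<open>g\<close>. So the equality also covers points where
  neither is differentiable, which the induction for iterates relies on.\<close>

lemma angular_deriv_cong:
  assumes "open_in_S1 W" "z \<in> W" "\<And>x. x \<in> W \<Longrightarrow> f x = g x"
  shows "angular_deriv f z = angular_deriv g z"
proof -
  have "has_angular_deriv f d z \<longleftrightarrow> has_angular_deriv g d z" for d
    by (rule has_angular_deriv_cong[OF assms])
  then show ?thesis
    unfolding angular_deriv_def vector_derivative_def has_angular_deriv_def by simp
qed

lemma funpow_angular_deriv_cong:
  assumes "open_in_S1 W" "\<And>x. x \<in> W \<Longrightarrow> f x = g x" "z \<in> W"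
  shows "(angular_deriv ^^ n) f z = (angular_deriv ^^ n) g z"
  using assms(3)
proof (induction n arbitrary: z)
  case (Suc n)
  show ?case
    using angular_deriv_cong[OF assms(1) Suc.prems Suc.IH] by simp
qed (use assms in auto)

lemma smooth_fun_on_iff:
  "smooth_fun_on U f \<longleftrightarrow> (\<forall>n. \<forall>z\<in>U. \<exists>d. has_angular_deriv ((angular_deriv ^^ n) f) d z)"
  unfolding smooth_fun_on_def differentiable_iff_has_angular_deriv
  by (metis angular_deriv_eqI)

lemma smooth_fun_onD:
  assumes "smooth_fun_on U f" "z \<in> U"
  shows "has_angular_deriv f (angular_deriv f z) z"
  using assms unfolding smooth_fun_on_def differentiable_iff_has_angular_deriv
  by (metis funpow_0)

lemma smooth_fun_on_subset: "smooth_fun_on U f \<Longrightarrow> V \<subseteq> U \<Longrightarrow> smooth_fun_on V f"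
  unfolding smooth_fun_on_def by blast

lemma smooth_fun_on_angular_deriv:
  "smooth_fun_on U f \<Longrightarrow> smooth_fun_on U (angular_deriv f)"
  unfolding smooth_fun_on_def by (metis comp_apply funpow_Suc_right)

text \<open>The comparison function \<open>g\<close> may change from point to point. This is how
  globally defined functions are proved smooth when only local signs are at hand.\<close>

lemma smooth_fun_on_locally:
  assumes "\<And>z. z \<in> U \<Longrightarrow> \<exists>W g. open_in_S1 W \<and> z \<in> W \<and> smooth_fun_on W g \<and> (\<forall>x\<in>W. f x = g x)"
  shows "smooth_fun_on U f"
  unfolding smooth_fun_on_iff
proof (intro allI ballI)
  fix n z assume "z \<in> U"
  then obtain W g where W: "open_in_S1 W" "z \<in> W" "smooth_fun_on W g" "\<And>x. x \<in> W \<Longrightarrow> f x = g x"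
    using assms by metis
  obtain d where "has_angular_deriv ((angular_deriv ^^ n) g) d z"
    using W unfolding smooth_fun_on_iff by blast
  then show "\<exists>d. has_angular_deriv ((angular_deriv ^^ n) f) d z"
    using has_angular_deriv_cong[OF W(1,2), of "(angular_deriv ^^ n) f" "(angular_deriv ^^ n) g"]
      funpow_angular_deriv_cong[OF W(1), of f g] W(4) by blast
qed

lemma smooth_fun_on_cong:
  assumes "open_in_S1 U" "smooth_fun_on U g" "\<And>x. x \<in> U \<Longrightarrow> f x = g x"
  shows "smooth_fun_on U f"
  by (rule smooth_fun_on_locally) (use assms in blast)

text \<open>A class of functions closed under differentiation on \<open>U\<close> consists of smooth
  functions: the invariant \<open>P\<close> survives each derivative.\<close>

lemma smooth_fun_on_coinduct:
  assumes "open_in_S1 U" "P f"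
    and step: "\<And>f. P f \<Longrightarrow> \<exists>g. P g \<and> (\<forall>z\<in>U. has_angular_deriv f (g z) z)"
  shows "smooth_fun_on U f"
proof -
  have "P f \<Longrightarrow> z \<in> U \<Longrightarrow> \<exists>d. has_angular_deriv ((angular_deriv ^^ n) f) d z" for n f z
  proof (induction n arbitrary: f z)
    case 0
    then show ?case using step by fastforce
  next
    case (Suc n)
    obtain g where g: "P g" "\<forall>x\<in>U. has_angular_deriv f (g x) x"
      using step Suc.prems by blast
    obtain d where "has_angular_deriv ((angular_deriv ^^ n) g) d z"
      using Suc.IH[OF g(1) Suc.prems(2)] by blast
    \<comment> \<open>\<open>g\<close> and \<open>angular_deriv f\<close> are only known to agree on
      \<open>U\<close>, so the iterates are compared there and not as functions.\<close>
    then have "has_angular_deriv ((angular_deriv ^^ n) (angular_deriv f)) d z"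
      by (subst has_angular_deriv_cong[OF assms(1) Suc.prems(2)])
        (auto intro!: funpow_angular_deriv_cong[OF assms(1)] angular_deriv_eqI g(2)[rule_format])
    then show ?case by (auto simp: funpow_swap1)
  qed
  then show ?thesis using assms(2) unfolding smooth_fun_on_iff by blast
qed

section \<open>Rules of differentiation along the flow\<close>

lemma has_angular_deriv_const: "has_angular_deriv (\<lambda>z. c) 0 z"
  unfolding has_angular_deriv_def by simp

lemma has_angular_deriv_ident: "has_angular_deriv (\<lambda>z. z) (\<i> * z) z"
proof -
  have "((\<lambda>t. cis t) has_vector_derivative \<i>) (at 0)"
    using has_derivative_cis[of "\<lambda>t. t" "\<lambda>t. t" 0 UNIV]
    by (simp add: has_vector_derivative_def cis_conv_exp scaleR_conv_of_real)
  then have "((\<lambda>t. z * cis t) has_vector_derivative z * \<i>) (at 0)"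
    by (rule has_vector_derivative_mult_right)
  then show ?thesis unfolding has_angular_deriv_def by (simp add: mult.commute)
qed

lemma has_angular_deriv_add:
  "has_angular_deriv f d z \<Longrightarrow> has_angular_deriv g e z \<Longrightarrow>
    has_angular_deriv (\<lambda>x. f x + g x) (d + e) z"
  unfolding has_angular_deriv_def by (rule has_vector_derivative_add)

lemma has_angular_deriv_mult:
  "has_angular_deriv f d z \<Longrightarrow> has_angular_deriv g e z \<Longrightarrow>
    has_angular_deriv (\<lambda>x. f x * g x) (d * g z + f z * e) z"
  unfolding has_angular_deriv_def
  by (drule (1) has_vector_derivative_mult) (simp add: add.commute)

lemma has_angular_deriv_cnj:
  "has_angular_deriv f d z \<Longrightarrow> has_angular_deriv (\<lambda>x. cnj (f x)) (cnj d) z"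
  unfolding has_angular_deriv_def by (rule has_vector_derivative_cnj)

lemma has_angular_deriv_sum:
  assumes "\<And>i. i \<in> I \<Longrightarrow> has_angular_deriv (f i) (d i) z"
  shows "has_angular_deriv (\<lambda>x. \<Sum>i\<in>I. f i x) (\<Sum>i\<in>I. d i) z"
  using assms
proof (induction I rule: infinite_finite_induct)
  case (insert i I)
  then show ?case by (auto intro!: has_angular_deriv_add)
qed (auto intro: has_angular_deriv_const)

text \<open>Products of smooth functions are not themselves closed under differentiation. This closure is,
  which makes the coinduction go through.\<close>

inductive smooth_term :: "complex set \<Rightarrow> (complex \<Rightarrow> complex) \<Rightarrow> bool" for U where
  base: "smooth_fun_on U f \<Longrightarrow> smooth_term U f"
| const: "smooth_term U (\<lambda>z. c)"
| ident: "smooth_term U (\<lambda>z. z)"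
| add: "smooth_term U f \<Longrightarrow> smooth_term U g \<Longrightarrow> smooth_term U (\<lambda>z. f z + g z)"
| mult: "smooth_term U f \<Longrightarrow> smooth_term U g \<Longrightarrow> smooth_term U (\<lambda>z. f z * g z)"
| cnj: "smooth_term U f \<Longrightarrow> smooth_term U (\<lambda>z. cnj (f z))"

lemma smooth_term_step:
  assumes "smooth_term U f"
  shows "\<exists>g. smooth_term U g \<and> (\<forall>z\<in>U. has_angular_deriv f (g z) z)"
  using assms
proof induction
  case (base f)
  then show ?case
    by (blast intro: smooth_term.base smooth_fun_on_angular_deriv smooth_fun_onD)
next
  case (const c)
  show ?case by (rule exI[of _ "\<lambda>z. 0"]) (auto intro: smooth_term.const has_angular_deriv_const)
next
  case ident
  show ?case
    by (rule exI[of _ "\<lambda>z. \<i> * z"]) (simp add: has_angular_deriv_ident smooth_term.mult smooth_term.const smooth_term.ident)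
next
  case (add f g)
  then obtain f' g' where "smooth_term U f'" "\<forall>z\<in>U. has_angular_deriv f (f' z) z"
    "smooth_term U g'" "\<forall>z\<in>U. has_angular_deriv g (g' z) z" by blast
  then show ?case
    by (intro exI[of _ "\<lambda>z. f' z + g' z"]) (simp add: has_angular_deriv_add smooth_term.add)
next
  case (mult f g)
  then obtain f' g' where "smooth_term U f'" "\<forall>z\<in>U. has_angular_deriv f (f' z) z"
    "smooth_term U g'" "\<forall>z\<in>U. has_angular_deriv g (g' z) z" by blast
  then show ?case
    by (intro exI[of _ "\<lambda>z. f' z * g z + f z * g' z"])
      (simp add: has_angular_deriv_mult smooth_term.add smooth_term.mult mult.hyps)
next
  case (cnj f)
  then obtain f' where "smooth_term U f'" "\<forall>z\<in>U. has_angular_deriv f (f' z) z" by blast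
  then show ?case
    by (intro exI[of _ "\<lambda>z. cnj (f' z)"]) (simp add: has_angular_deriv_cnj smooth_term.cnj)
qed

lemma smooth_fun_on_term: "open_in_S1 U \<Longrightarrow> smooth_term U f \<Longrightarrow> smooth_fun_on U f"
  by (rule smooth_fun_on_coinduct[of _ "smooth_term U"]) (assumption | rule smooth_term_step)+

lemma smooth_fun_on_const: "open_in_S1 U \<Longrightarrow> smooth_fun_on U (\<lambda>z. c)"
  by (rule smooth_fun_on_term[OF _ smooth_term.const])

lemma smooth_fun_on_mult:
  "open_in_S1 U \<Longrightarrow> smooth_fun_on U f \<Longrightarrow> smooth_fun_on U g \<Longrightarrow> smooth_fun_on U (\<lambda>z. f z * g z)"
  by (rule smooth_fun_on_term[OF _ smooth_term.mult[OF smooth_term.base smooth_term.base]])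

lemma smooth_fun_on_add:
  "open_in_S1 U \<Longrightarrow> smooth_fun_on U f \<Longrightarrow> smooth_fun_on U g \<Longrightarrow> smooth_fun_on U (\<lambda>z. f z + g z)"
  by (rule smooth_fun_on_term[OF _ smooth_term.add[OF smooth_term.base smooth_term.base]])

lemma smooth_fun_on_cnj:
  "open_in_S1 U \<Longrightarrow> smooth_fun_on U f \<Longrightarrow> smooth_fun_on U (\<lambda>z. cnj (f z))"
  by (rule smooth_fun_on_term[OF _ smooth_term.cnj[OF smooth_term.base]])

lemma smooth_fun_on_sum:
  assumes "open_in_S1 U" "\<And>i. i \<in> I \<Longrightarrow> smooth_fun_on U (f i)"
  shows "smooth_fun_on U (\<lambda>z. \<Sum>i\<in>I. f i z)"
  using assms(2)
  by (induction I rule: infinite_finite_induct)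
    (auto intro: smooth_fun_on_const smooth_fun_on_add assms(1))

text \<open>On the circle the inverse of \<open>z\<close> is \<open>cnj z\<close>, and for a tangent
  vector the quotient by \<open>\<i> * z\<close> is already real. The coordinate is therefore a
  product of smooth functions, with no quotient rule and no real part to differentiate.\<close>

lemma smooth_fun_on_tangent_coord:
  assumes U: "open_in_S1 U" and X: "smooth_field_on U X"
  shows "smooth_fun_on U (\<lambda>z. of_real (tangent_coord z (X z)))"
proof (rule smooth_fun_on_cong[OF U])
  have "smooth_term U X" using X by (auto simp: smooth_field_on_def intro: smooth_term.base)
  then show "smooth_fun_on U (\<lambda>z. X z * (cnj z * (- \<i>)))"
    by (intro smooth_fun_on_term[OF U] smooth_term.mult smooth_term.cnj smooth_term.const smooth_term.ident)
  fix z assume z: "z \<in> U"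
  then have n: "norm z = 1" using openin_imp_subset[OF U] by auto
  then have zz: "z * cnj z = 1" by (simp add: complex_norm_square[symmetric])
  obtain a where a: "X z = of_real a * (\<i> * z)"
    using X z unfolding smooth_field_on_def tangent_S1_def by blast
  have "z \<noteq> 0" using n by auto
  then have "tangent_coord z (X z) = a" unfolding tangent_coord_def a by simp
  moreover have "X z * (cnj z * (- \<i>)) = of_real a * (z * cnj z)"
    unfolding a by (simp add: algebra_simps)
  ultimately show "of_real (tangent_coord z (X z)) = X z * (cnj z * (- \<i>))"
    using zz by simp
qed

lemma tangent_coord_scaled:
  "z \<in> S1 \<Longrightarrow> tangent_coord z (of_real a * (\<i> * z)) = a"
  unfolding tangent_coord_def by (cases "z = 0") auto

lemma tangent_coord_add: "tangent_coord z (v + w) = tangent_coord z v + tangent_coord z w"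
  by (simp add: tangent_coord_def add_divide_distrib)

lemma tangent_coord_scale: "tangent_coord z (of_real a * v) = a * tangent_coord z v"
  by (simp add: tangent_coord_def flip: times_divide_eq_right)

text \<open>Smoothness only speaks of single flow lines. Continuity on the circle follows by
  inverting the flow: a point \<open>x\<close> is reached from \<open>z\<close> at time
  \<open>Arg (x / z)\<close>.\<close>

lemma smooth_imp_continuous_on_S1:
  assumes "smooth_fun_on S1 f"
  shows "continuous_on S1 f"
  unfolding continuous_on_def
proof
  fix z :: complex assume z: "z \<in> S1"
  then have z0: "z \<noteq> 0" by auto
  have "isCont (\<lambda>t::real. f (z * cis t)) 0"
    using smooth_fun_onD[OF assms z] unfolding has_angular_deriv_def
    by (rule has_vector_derivative_continuous)
  moreover have "isCont (\<lambda>x. Arg (x / z)) z"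
    by (intro continuous_intros continuous_at_compose[unfolded o_def, of z "\<lambda>x. x / z" Arg] continuous_at_Arg)
      (use z0 in auto)
  ultimately have "isCont (\<lambda>x. f (z * cis (Arg (x / z)))) z"
    using z0 isCont_o2[of z "\<lambda>x. Arg (x / z)" "\<lambda>t. f (z * cis t)"] by (simp add: Arg_eq_0)
  then have "((\<lambda>x. f (z * cis (Arg (x / z)))) \<longlongrightarrow> f z) (at z within S1)"
    using z0 by (auto simp: isCont_def intro: tendsto_within_subset)
  then show "(f \<longlongrightarrow> f z) (at z within S1)"
  proof (rule Lim_transform_eventually)
    have "f (z * cis (Arg (x / z))) = f x" if "x \<in> S1" for x
    proof -
      have "x / z \<noteq> 0" "norm (x / z) = 1" using that z by (auto simp: norm_divide)
      then have "cis (Arg (x / z)) = x / z" by (simp add: cis_Arg sgn_eq)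
      then show ?thesis using z0 by simp
    qed
    then show "\<forall>\<^sub>F x in at z within S1. f (z * cis (Arg (x / z))) = f x"
      by (auto simp: eventually_at_filter)
  qed
qed

text \<open>The flow line through 1 covers the whole circle, so \<open>f\<close> pulls back to a
  function on the real line with zero derivative at every time; the flow from \<open>cis t\<close>
  is a time shift of it.\<close>

lemma angular_deriv_zero_imp_constant:
  assumes f: "smooth_fun_on S1 f" and d: "\<And>z. z \<in> S1 \<Longrightarrow> angular_deriv f z = 0" and z: "z \<in> S1"
  shows "f z = f 1"
proof -
  have "((\<lambda>t. f (cis t)) has_vector_derivative 0) (at t)" for t
  proof -
    have "has_angular_deriv f 0 (cis t)"
      using smooth_fun_onD[OF f, of "cis t"] d[of "cis t"] by simp
    then have "((\<lambda>s. f (cis (t + s))) has_vector_derivative 0) (at 0)"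
      unfolding has_angular_deriv_def cis_mult .
    moreover have "((\<lambda>s. s - t) has_vector_derivative 1) (at t)"
      by (auto intro!: derivative_eq_intros)
    ultimately show ?thesis
      using vector_diff_chain_at[of "\<lambda>s. s - t" 1 t "\<lambda>s. f (cis (t + s))" 0] by (simp add: o_def)
  qed
  then obtain c where c: "\<And>t. f (cis t) = c"
    using has_vector_derivative_zero_constant[of UNIV "\<lambda>t. f (cis t)"] by auto
  have "f (cis (Arg z)) = f (cis 0)" by (simp only: c)
  moreover have "cis (Arg z) = z"
    using z by (subst cis_Arg) (auto simp: sgn_eq)
  ultimately show ?thesis by simp
qed


section \<open>Finite families of vectors\<close>

lemma sum_fun_apply: "(\<Sum>i\<in>I. f i) x = (\<Sum>i\<in>I. f i x)"
  by (induction I rule: infinite_finite_induct) auto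

lemma scale_vec_apply: "scale_vec c v i = c * v i"
  by (simp add: scale_vec_def)

context vector_space
begin

lemma independent_family:
  assumes "finite I" and zero: "\<And>u i. (\<Sum>i\<in>I. scale (u i) (b i)) = 0 \<Longrightarrow> i \<in> I \<Longrightarrow> u i = 0"
  shows "inj_on b I" "independent (b ` I)"
proof -
  show inj: "inj_on b I"
  proof (rule inj_onI, rule ccontr)
    fix i j assume ij: "i \<in> I" "j \<in> I" "b i = b j" "i \<noteq> j"
    \<comment> \<open>If \<open>b i = b j\<close>, the coefficients 1 at \<open>i\<close> and -1 at
      \<open>j\<close> give a vanishing combination.\<close>
    let ?u = "\<lambda>l. (if l = i then 1 else 0) - (if l = j then 1 else 0)"
    have "(\<Sum>l\<in>I. scale (?u l) (b l)) =
        (\<Sum>l\<in>I. if l = i then b l else 0) - (\<Sum>l\<in>I. if l = j then b l else 0)"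
      unfolding sum_subtractf[symmetric] by (rule sum.cong) (auto simp: scale_left_diff_distrib)
    also have "\<dots> = 0" using ij assms(1) by simp
    finally show False using zero[of ?u i] ij by simp
  qed
  show "independent (b ` I)"
  proof (rule independent_if_scalars_zero)
    fix f x assume "(\<Sum>x\<in>b ` I. scale (f x) x) = 0" "x \<in> b ` I"
    then show "f x = 0" using zero[of "\<lambda>i. f (b i)"] by (auto simp: sum.reindex[OF inj])
  qed (use assms in simp)
qed

lemma span_family:
  assumes "finite I" "inj_on b I"
  shows "x \<in> span (b ` I) \<longleftrightarrow> (\<exists>u. x = (\<Sum>i\<in>I. scale (u i) (b i)))"
proof
  assume "x \<in> span (b ` I)"
  then show "\<exists>u. x = (\<Sum>i\<in>I. scale (u i) (b i))"
    using assms by (auto simp: span_finite sum.reindex)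
qed (auto intro: span_sum span_scale span_base)

end

section \<open>The spinor bundle in a pointwise trivialisation\<close>

locale spin_circle_context =
  fixes M :: "('p::topological_space) spin_circle"
  assumes spin: "riemannian_spin_circle M"
begin

abbreviation act :: "'p \<Rightarrow> real \<Rightarrow> 'p" where
  "act \<equiv> spin_act M"

abbreviation tot :: "'p set" where
  "tot \<equiv> spin_total M"

section \<open>The metric and the oriented unit tangent field\<close>

definition ut_coeff :: "complex \<Rightarrow> real" where
  "ut_coeff z = orient M / sqrt (riem M z (\<i> * z) (\<i> * z))"

lemma metric_pos: "z \<in> S1 \<Longrightarrow> riem M z (\<i> * z) (\<i> * z) > 0"
proof -
  assume z: "z \<in> S1"
  have "\<i> * z \<in> tangent_S1 z" unfolding tangent_S1_def by (auto intro!: image_eqI[of _ _ 1])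
  moreover have "\<i> * z \<noteq> 0" using z by auto
  ultimately show ?thesis
    using spin z unfolding riemannian_spin_circle_def riemannian_metric_S1_def by blast
qed

lemma orient_cases: "orient M = 1 \<or> orient M = -1"
  using spin unfolding riemannian_spin_circle_def by simp

text \<open>Because \<open>SO(1)\<close> is trivial, the oriented frame bundle is the graph of one
  vector field. This justifies the description in \<open>unit_tangent\<close> and lets the spin
  bundle be read as a double cover of the circle itself.\<close>

lemma oriented_frames_iff:
  assumes z: "z \<in> S1"
  shows "(z, v) \<in> oriented_frames (riem M) (orient M) \<longleftrightarrow> v = of_real (ut_coeff z) * (\<i> * z)"
proof -
  let ?G = "riem M z (\<i> * z) (\<i> * z)"
  have T: "of_real a * (\<i> * z) \<in> tangent_S1 z" for a :: real unfolding tangent_S1_def by blast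
  have T1: "\<i> * z \<in> tangent_S1 z" using T[of 1] by simp
  have G: "?G > 0" by (rule metric_pos[OF z])
  have rm: "riemannian_metric_S1 (riem M)" using spin unfolding riemannian_spin_circle_def by simp
  have lin: "riem M z (of_real a * u) w = a * riem M z u w"
    and sym: "riem M z u w = riem M z w u"
    if "u \<in> tangent_S1 z" "w \<in> tangent_S1 z" for a u w
    using rm z that unfolding riemannian_metric_S1_def by blast+
  have sq: "riem M z (of_real a * (\<i> * z)) (of_real a * (\<i> * z)) = a\<^sup>2 * ?G" for a
    using lin[OF T1 T, of a a] sym[OF T1 T, of a] lin[OF T1 T1, of a] by (simp add: power2_eq_square)
  \<comment> \<open>Unit length leaves two solutions of opposite sign; the orientation selects one
    of them.\<close>
  have main: "a\<^sup>2 * ?G = 1 \<and> orient M * a > 0 \<longleftrightarrow> a = ut_coeff z" for a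
  proof -
    define s where "s = sqrt ?G"
    have s: "s > 0" "?G = s\<^sup>2" using G by (auto simp: s_def)
    have "a\<^sup>2 * s\<^sup>2 = 1 \<longleftrightarrow> a * s = 1 \<or> a * s = -1"
      by (metis power2_eq_1_iff power_mult_distrib)
    also have "\<dots> \<longleftrightarrow> a = 1 / s \<or> a = - 1 / s" using s by (auto simp: field_simps)
    finally have e: "a\<^sup>2 * s\<^sup>2 = 1 \<longleftrightarrow> a = 1 / s \<or> a = - 1 / s" .
    have p: "1 / s > 0" using s by simp
    have "orient M * a > 0 \<longleftrightarrow> (if orient M = 1 then a > 0 else a < 0)"
      using orient_cases by auto
    moreover have "ut_coeff z = (if orient M = 1 then 1 / s else - 1 / s)"
      using orient_cases unfolding ut_coeff_def s_def by auto
    moreover have "a\<^sup>2 * ?G = 1 \<longleftrightarrow> a = 1 / s \<or> a = - 1 / s" unfolding s(2) by (rule e)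
    ultimately show ?thesis using p by (smt (verit, best) minus_divide_left)
  qed
  show ?thesis
  proof
    assume "(z, v) \<in> oriented_frames (riem M) (orient M)"
    then obtain a :: real where a: "v = of_real a * (\<i> * z)" "riem M z v v = 1" "orient M * tangent_coord z v > 0"
      unfolding oriented_frames_def tangent_S1_def by blast
    then show "v = of_real (ut_coeff z) * (\<i> * z)"
      using main[of a] sq[of a] tangent_coord_scaled[OF z, of a] by simp
  next
    assume v: "v = of_real (ut_coeff z) * (\<i> * z)"
    then show "(z, v) \<in> oriented_frames (riem M) (orient M)"
      using main[of "ut_coeff z"] sq[of "ut_coeff z"] tangent_coord_scaled[OF z, of "ut_coeff z"] z T
      unfolding oriented_frames_def by auto
  qed
qed

lemma unit_tangent_eq: "z \<in> S1 \<Longrightarrow> unit_tangent M z = of_real (ut_coeff z) * (\<i> * z)"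
  unfolding unit_tangent_def oriented_frames_iff by blast

lemma unit_tangent_frame: "z \<in> S1 \<Longrightarrow> (z, unit_tangent M z) \<in> oriented_frames (riem M) (orient M)"
  by (simp add: oriented_frames_iff unit_tangent_eq)

lemma riem_unit_tangent: "z \<in> S1 \<Longrightarrow> riem M z (unit_tangent M z) (unit_tangent M z) = 1"
  using unit_tangent_frame unfolding oriented_frames_def by blast

lemma tangent_coord_unit_tangent: "z \<in> S1 \<Longrightarrow> tangent_coord z (unit_tangent M z) \<noteq> 0"
  using unit_tangent_frame unfolding oriented_frames_def by force

text \<open>Needed to turn local inverses of the covering, which live over the frame bundle, into
  spin frames over open sets of the circle.\<close>

lemma continuous_on_unit_tangent: "continuous_on S1 (unit_tangent M)"
proof -
  have "smooth_fun_on S1 (\<lambda>z. of_real (riem M z (\<i> * z) (\<i> * z)))"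
    using spin unfolding riemannian_spin_circle_def riemannian_metric_S1_def by blast
  then have "continuous_on S1 (\<lambda>z. Re (of_real (riem M z (\<i> * z) (\<i> * z))))"
    by (intro continuous_on_Re smooth_imp_continuous_on_S1)
  then have G: "continuous_on S1 (\<lambda>z. riem M z (\<i> * z) (\<i> * z))" by simp
  have "sqrt (riem M z (\<i> * z) (\<i> * z)) \<noteq> 0" if "z \<in> S1" for z
    using metric_pos[OF that] by simp
  then have "continuous_on S1 (\<lambda>z. of_real (ut_coeff z) * (\<i> * z))"
    unfolding ut_coeff_def
    by (intro continuous_on_mult continuous_on_of_real continuous_on_divide continuous_on_const
        continuous_on_real_sqrt G continuous_on_id) simp
  then show ?thesis
    by (rule continuous_on_eq) (simp add: unit_tangent_eq)
qed

section \<open>The action of \<open>Spin1\<close> on the spin bundle\<close>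

lemma covering: "covering_space tot (spin_cover M) (oriented_frames (riem M) (orient M))"
  using spin unfolding riemannian_spin_circle_def spin_structure_def by blast

lemma act_in: "p \<in> tot \<Longrightarrow> a \<in> Spin1 \<Longrightarrow> act p a \<in> tot"
  using spin unfolding riemannian_spin_circle_def spin_structure_def by (simp add: image_subset_iff)

lemma act_continuous: "a \<in> Spin1 \<Longrightarrow> continuous_on tot (\<lambda>p. act p a)"
  using spin unfolding riemannian_spin_circle_def spin_structure_def by simp

lemma act_one: "p \<in> tot \<Longrightarrow> act p 1 = p"
  using spin unfolding riemannian_spin_circle_def spin_structure_def by simp

lemma act_mult: "p \<in> tot \<Longrightarrow> a \<in> Spin1 \<Longrightarrow> b \<in> Spin1 \<Longrightarrow> act (act p a) b = act p (a * b)"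
  using spin unfolding riemannian_spin_circle_def spin_structure_def by simp

lemma cover_act: "p \<in> tot \<Longrightarrow> a \<in> Spin1 \<Longrightarrow> spin_cover M (act p a) = spin_cover M p"
  using spin unfolding riemannian_spin_circle_def spin_structure_def by simp

lemma act_free: "p \<in> tot \<Longrightarrow> a \<in> Spin1 \<Longrightarrow> act p a = p \<Longrightarrow> a = 1"
  using spin unfolding riemannian_spin_circle_def spin_structure_def by simp

lemma act_transitive:
  "p \<in> tot \<Longrightarrow> q \<in> tot \<Longrightarrow> spin_cover M p = spin_cover M q \<Longrightarrow> \<exists>a\<in>Spin1. q = act p a"
  using spin unfolding riemannian_spin_circle_def spin_structure_def by simp

lemma Spin1_mult: "a \<in> Spin1 \<Longrightarrow> b \<in> Spin1 \<Longrightarrow> a * b \<in> Spin1"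
  unfolding Spin1_def by auto

lemma Spin1_square: "a \<in> Spin1 \<Longrightarrow> a * a = 1"
  unfolding Spin1_def by auto

lemma act_inj: "p \<in> tot \<Longrightarrow> a \<in> Spin1 \<Longrightarrow> b \<in> Spin1 \<Longrightarrow> act p a = act p b \<Longrightarrow> a = b"
proof -
  assume *: "p \<in> tot" "a \<in> Spin1" "b \<in> Spin1" "act p a = act p b"
  then have "act p (a * b) = p"
    by (metis act_mult act_one Spin1_square)
  then have "a * b = 1" using * by (intro act_free Spin1_mult)
  then show "a = b" using * unfolding Spin1_def by auto
qed

lemma cover_frame: "p \<in> tot \<Longrightarrow> spin_cover M p \<in> oriented_frames (riem M) (orient M)"
  using covering_space_imp_surjective[OF covering] by blast

lemma base_point_in: "p \<in> tot \<Longrightarrow> base_point M p \<in> S1"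
  using cover_frame[of p] unfolding base_point_def oriented_frames_def by auto

text \<open>Consequently two points of the spin bundle lie in the same orbit as soon as their base
  points agree.\<close>

lemma cover_eq: "p \<in> tot \<Longrightarrow> spin_cover M p = (base_point M p, unit_tangent M (base_point M p))"
  using cover_frame[of p] base_point_in[of p] oriented_frames_iff[of "base_point M p"]
    unit_tangent_eq[of "base_point M p"]
  unfolding base_point_def by (metis prod.collapse)

lemma base_point_act: "p \<in> tot \<Longrightarrow> a \<in> Spin1 \<Longrightarrow> base_point M (act p a) = base_point M p"
  unfolding base_point_def by (simp add: cover_act)

text \<open>An arbitrary, in general discontinuous, choice of a spin frame at each point of the circle.\<close>

definition rep :: "complex \<Rightarrow> 'p" where
  "rep z = (SOME p. p \<in> tot \<and> base_point M p = z)"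

lemma rep:
  assumes "z \<in> S1"
  shows "rep z \<in> tot" "base_point M (rep z) = z"
proof -
  obtain p where p: "p \<in> tot" "spin_cover M p = (z, unit_tangent M z)"
    using covering_space_imp_surjective[OF covering] unit_tangent_frame[OF assms]
    by (metis imageE)
  then have "\<exists>p. p \<in> tot \<and> base_point M p = z"
    by (intro exI[of _ p]) (simp add: base_point_def)
  then have "rep z \<in> tot \<and> base_point M (rep z) = z" unfolding rep_def by (rule someI_ex)
  then show "rep z \<in> tot" "base_point M (rep z) = z" by auto
qed

text \<open>The position of \<open>p\<close> in its orbit relative to the chosen representative: an
  equivariant function on the spin bundle (\<open>sg_act\<close>), in general as discontinuous as
  \<open>rep\<close>.\<close>

definition sg :: "'p \<Rightarrow> real" where
  "sg p = (SOME a. a \<in> Spin1 \<and> p = act (rep (base_point M p)) a)"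

lemma sg:
  assumes "p \<in> tot"
  shows "sg p \<in> Spin1" "act (rep (base_point M p)) (sg p) = p"
proof -
  let ?r = "rep (base_point M p)"
  have r: "?r \<in> tot" "base_point M ?r = base_point M p" using rep base_point_in assms by auto
  have "\<exists>a\<in>Spin1. p = act ?r a"
    by (rule act_transitive[OF r(1) assms]) (simp add: cover_eq r assms)
  then have "\<exists>a. a \<in> Spin1 \<and> p = act ?r a" by blast
  from someI_ex[OF this] have "sg p \<in> Spin1 \<and> p = act ?r (sg p)" unfolding sg_def .
  then show "sg p \<in> Spin1" "act ?r (sg p) = p" by auto
qed

lemma sg_act:
  assumes "p \<in> tot" "a \<in> Spin1"
  shows "sg (act p a) = sg p * a"
proof -
  have r: "rep (base_point M p) \<in> tot" using rep base_point_in assms by auto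
  have "act (rep (base_point M p)) (sg (act p a)) = act p a"
    using sg(2)[OF act_in[OF assms]] by (simp add: base_point_act assms)
  also have "\<dots> = act (rep (base_point M p)) (sg p * a)"
    using sg[OF assms(1)] act_mult[OF r _ assms(2)] by metis
  finally show ?thesis
    by (rule act_inj[OF r sg(1)[OF act_in[OF assms]] Spin1_mult[OF sg(1)[OF assms(1)] assms(2)]])
qed

section \<open>Spinors relative to the pointwise choice\<close>

definition base_spinor :: "complex \<Rightarrow> 'p \<Rightarrow> complex" where
  "base_spinor z = spinor M (rep z) 1"

lemma spinor_act:
  assumes "p \<in> tot" "a \<in> Spin1"
  shows "spinor M p w (act p a) = of_real a * w"
proof -
  have "spinor M p w (act p a) = (\<Sum>b\<in>Spin1. if b = a then of_real (inverse b) * w else 0)"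
    unfolding spinor_def by (rule sum.cong) (use act_inj assms in auto)
  also have "\<dots> = of_real (inverse a) * w" using assms by (simp add: Spin1_def)
  also have "inverse a = a" using assms(2) by (auto simp: Spin1_def)
  finally show ?thesis .
qed

lemma spinor_outside: "(\<And>a. a \<in> Spin1 \<Longrightarrow> r \<noteq> act p a) \<Longrightarrow> spinor M p w r = 0"
  unfolding spinor_def by (auto intro: sum.neutral)

text \<open>This is the relation [p a, w] = [p, a w] of the associated bundle, applied to
  \<open>p\<close> as the translate of the representative by \<open>sg p\<close>.\<close>

lemma spinor_eq_scale:
  assumes p: "p \<in> tot"
  shows "spinor M p w = scale_vec (of_real (sg p) * w) (base_spinor (base_point M p))"
proof
  fix r
  let ?q = "rep (base_point M p)"
  have q: "?q \<in> tot" using rep base_point_in p by auto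
  note s = sg[OF p]
  show "spinor M p w r = scale_vec (of_real (sg p) * w) (base_spinor (base_point M p)) r"
  proof (cases "\<exists>a\<in>Spin1. r = act p a")
    case True
    then obtain a where a: "a \<in> Spin1" "r = act p a" by blast
    have r: "r = act ?q (sg p * a)" using a s act_mult[OF q s(1) a(1)] by simp
    have "base_spinor (base_point M p) r = of_real (sg p * a) * 1"
      unfolding base_spinor_def r by (rule spinor_act[OF q Spin1_mult[OF s(1) a(1)]])
    moreover have "spinor M p w r = of_real a * w" unfolding a(2) by (rule spinor_act[OF p a(1)])
    moreover have "of_real (sg p) * of_real (sg p) = (1::complex)"
      using Spin1_square[OF s(1)] by (metis of_real_1 of_real_mult)
    ultimately show ?thesis by (simp add: scale_vec_def algebra_simps)
  next
    case False
    have "r \<noteq> act ?q b" if b: "b \<in> Spin1" for b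
    proof
      assume "r = act ?q b"
      also have "?q = act p (sg p)"
        using s act_mult[OF q s(1) s(1)] Spin1_square[OF s(1)] act_one[OF q] by simp
      finally have "r = act p (sg p * b)" using act_mult[OF p s(1) b] by simp
      then show False using False Spin1_mult[OF s(1) b] by blast
    qed
    then show ?thesis using False by (simp add: spinor_outside base_spinor_def scale_vec_def)
  qed
qed

lemma base_spinor_rep: "z \<in> S1 \<Longrightarrow> base_spinor z (rep z) = 1"
  unfolding base_spinor_def using spinor_act[of "rep z" 1 1] rep[of z] act_one[of "rep z"] by (simp add: Spin1_def)

text \<open>On the orbit over its base point the reference spinor, as an equivariant function, is
  \<open>sg\<close> itself.\<close>

lemma base_spinor_eq_sg:
  assumes p: "p \<in> tot"
  shows "base_spinor (base_point M p) p = of_real (sg p)"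
  using spinor_act[OF rep(1)[OF base_point_in[OF p]] sg(1)[OF p], of 1] sg(2)[OF p]
  unfolding base_spinor_def by simp

lemma spinor_fibre:
  assumes z: "z \<in> S1"
  shows "fibre (spinor_bundle M) z = range (\<lambda>w. scale_vec w (base_spinor z))"
proof -
  have "spinor M p w \<in> range (\<lambda>w. scale_vec w (base_spinor z))" if "p \<in> tot" "base_point M p = z" for p w
    using spinor_eq_scale[OF that(1), of w] that(2) by auto
  moreover have "scale_vec w (base_spinor z) \<in> {spinor M p w | p w. p \<in> tot \<and> base_point M p = z}" for w
  proof -
    \<comment> \<open>\<open>sg\<close> is a choice, so its value at the representative is read off
      from the value of \<open>base_spinor\<close> there.\<close>
    have "sg (rep z) = 1"
      using base_spinor_eq_sg[OF rep(1)[OF z]] rep(2)[OF z] base_spinor_rep[OF z] by simp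
    then have "scale_vec w (base_spinor z) = spinor M (rep z) w"
      using spinor_eq_scale[OF rep(1)[OF z], of w] rep(2)[OF z] by simp
    then show ?thesis using rep[OF z] by blast
  qed
  ultimately show ?thesis unfolding spinor_bundle_def by auto
qed

lemma spinor_fibreD: "z \<in> S1 \<Longrightarrow> s \<in> fibre (spinor_bundle M) z \<Longrightarrow> s = scale_vec (s (rep z)) (base_spinor z)"
  unfolding spinor_fibre by (auto simp: scale_vec_def base_spinor_rep)

text \<open>The scalar form of a local spin frame: by \<open>spinor_eq_scale\<close>, the parallel
  section [q, 1] equals \<eta> times \<open>base_spinor\<close>. From here on frames of the spinor
  bundle can be handled as functions with values 1 and -1.\<close>

definition local_sign :: "complex set \<Rightarrow> (complex \<Rightarrow> complex) \<Rightarrow> bool" where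
  "local_sign U \<eta> \<longleftrightarrow> (\<exists>q. local_spin_frame M U q \<and> \<eta> = (\<lambda>z. of_real (sg (q z))))"

lemma local_sign_open: "local_sign U \<eta> \<Longrightarrow> open_in_S1 U"
  unfolding local_sign_def local_spin_frame_def by blast

lemma local_sign_sub: "local_sign U \<eta> \<Longrightarrow> U \<subseteq> S1"
  using local_sign_open openin_imp_subset by blast

lemma local_sign_real:
  assumes "local_sign U \<eta>" "z \<in> U"
  shows "\<eta> z = 1 \<or> \<eta> z = -1"
proof -
  obtain q where "q z \<in> tot" "\<eta> z = of_real (sg (q z))"
    using assms unfolding local_sign_def local_spin_frame_def by blast
  then show ?thesis using sg(1)[of "q z"] unfolding Spin1_def by auto
qed

lemma local_sign_square: "local_sign U \<eta> \<Longrightarrow> z \<in> U \<Longrightarrow> \<eta> z * \<eta> z = 1"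
  using local_sign_real by fastforce

text \<open>A local inverse of the covering near \<open>rep z\<close>, composed with the frame field
  given by the unit tangent, is a continuous spin frame near \<open>z\<close>.\<close>

lemma local_sign_exists:
  assumes z: "z \<in> S1"
  shows "\<exists>U \<eta>. local_sign U \<eta> \<and> z \<in> U"
proof -
  obtain T u g where T: "rep z \<in> T" "openin (top_of_set tot) T" "spin_cover M (rep z) \<in> u"
      "openin (top_of_set (oriented_frames (riem M) (orient M))) u" "homeomorphism T u (spin_cover M) g"
    using covering_space_local_homeomorphism[OF covering rep(1)[OF z]] by metis
  let ?f = "\<lambda>x. (x, unit_tangent M x)"
  define U where "U = S1 \<inter> ?f -` u"
  have cf: "continuous_on S1 ?f"
    by (intro continuous_intros continuous_on_unit_tangent)
  have U: "open_in_S1 U" unfolding U_def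
    by (rule continuous_openin_preimage[OF cf _ T(4)]) (use unit_tangent_frame in auto)
  have zU: "z \<in> U" using T(3) cover_eq[OF rep(1)[OF z]] rep(2)[OF z] z unfolding U_def by auto
  have "local_spin_frame M U (\<lambda>x. g (?f x))"
    unfolding local_spin_frame_def
  proof (intro conjI ballI U)
    show "continuous_on U (\<lambda>x. g (?f x))"
      by (rule continuous_on_compose2[of u g U ?f])
        (use T(5) cf in \<open>auto simp: homeomorphism_def U_def intro: continuous_on_subset\<close>)
    fix x assume x: "x \<in> U"
    then have fx: "?f x \<in> u" unfolding U_def by blast
    then have gT: "g (?f x) \<in> T" using T(5) unfolding homeomorphism_def by blast
    then show "g (?f x) \<in> tot" using openin_imp_subset[OF T(2)] by blast
    have "spin_cover M (g (?f x)) = ?f x" using T(5) fx unfolding homeomorphism_def by blast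
    then show "base_point M (g (?f x)) = x" unfolding base_point_def by simp
  qed
  then show ?thesis using zU unfolding local_sign_def by blast
qed

text \<open>Two local lifts of the same frame field that agree at a point agree near it, because the
  covering map is locally injective; hence the ratio of two signs is locally constant even though
  each sign depends on the arbitrary choice of \<open>rep\<close>.\<close>

lemma local_sign_locally_constant:
  assumes "local_sign U \<eta>" "local_sign V \<theta>" "z \<in> U" "z \<in> V"
  shows "\<exists>W. open_in_S1 W \<and> z \<in> W \<and> W \<subseteq> U \<inter> V \<and> (\<forall>x\<in>W. \<eta> x * \<theta> x = \<eta> z * \<theta> z)"
proof -
  obtain q where q: "local_spin_frame M U q" "\<eta> = (\<lambda>z. of_real (sg (q z)))"
    using assms(1) unfolding local_sign_def by blast
  obtain r where r: "local_spin_frame M V r" "\<theta> = (\<lambda>z. of_real (sg (r z)))"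
    using assms(2) unfolding local_sign_def by blast
  have Q: "continuous_on U q" "open_in_S1 U" "\<And>x. x \<in> U \<Longrightarrow> q x \<in> tot \<and> base_point M (q x) = x"
    using q(1) unfolding local_spin_frame_def by auto
  have R: "continuous_on V r" "open_in_S1 V" "\<And>x. x \<in> V \<Longrightarrow> r x \<in> tot \<and> base_point M (r x) = x"
    using r(1) unfolding local_spin_frame_def by auto
  have Sq: "sg (q x) \<in> Spin1" if "x \<in> U" for x using that Q(3) sg(1) by blast
  have Sr: "sg (r x) \<in> Spin1" if "x \<in> V" for x using that R(3) sg(1) by blast
  \<comment> \<open>The element of \<open>Spin1\<close> that carries \<open>r z\<close> to
    \<open>q z\<close>, found by comparing both with \<open>rep z\<close>.\<close>
  define a where "a = sg (r z) * sg (q z)"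
  have a: "a \<in> Spin1" unfolding a_def by (intro Spin1_mult Sq Sr assms)
  have eqz: "act (r z) a = q z"
  proof -
    have "act (r z) a = act (act (rep z) (sg (r z))) a"
      using sg(2)[of "r z"] R(3)[OF assms(4)] by simp
    also have "\<dots> = act (rep z) (sg (r z) * a)"
      by (rule act_mult[OF rep(1) Sr[OF assms(4)] a]) (use local_sign_sub assms in blast)
    also have "sg (r z) * a = sg (q z)"
      using Spin1_square[OF Sr[OF assms(4)]] unfolding a_def by (simp flip: mult.assoc)
    also have "act (rep z) (sg (q z)) = q z" using sg(2)[of "q z"] Q(3)[OF assms(3)] by simp
    finally show ?thesis .
  qed
  obtain T u g where T: "q z \<in> T" "openin (top_of_set tot) T"
      "homeomorphism T u (spin_cover M) g"
    using covering_space_local_homeomorphism[OF covering] Q(3)[OF assms(3)] by metis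
  have inj: "inj_on (spin_cover M) T" using T(3) by (metis homeomorphism_def inj_on_inverseI)
  have o1: "openin (top_of_set U) (U \<inter> q -` T)"
    by (rule continuous_openin_preimage[OF Q(1) _ T(2)]) (use Q in auto)
  have ca: "continuous_on V (\<lambda>x. act (r x) a)"
    by (rule continuous_on_compose2[OF act_continuous[OF a] R(1)]) (use R in auto)
  have o2: "openin (top_of_set V) (V \<inter> (\<lambda>x. act (r x) a) -` T)"
    by (rule continuous_openin_preimage[OF ca _ T(2)]) (use R act_in a in auto)
  \<comment> \<open>Near \<open>z\<close> both \<open>q\<close> and the translate of
    \<open>r\<close> by \<open>a\<close> stay in \<open>T\<close>, where the covering map is
    injective; as they cover the same frame, they coincide.\<close>
  define W where "W = (U \<inter> q -` T) \<inter> (V \<inter> (\<lambda>x. act (r x) a) -` T)"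
  have "open_in_S1 W" unfolding W_def
    by (intro openin_Int openin_trans[OF o1 Q(2)] openin_trans[OF o2 R(2)])
  moreover have "z \<in> W" using assms T(1) eqz unfolding W_def by auto
  moreover have "W \<subseteq> U \<inter> V" unfolding W_def by auto
  moreover have "\<eta> x * \<theta> x = \<eta> z * \<theta> z" if "x \<in> W" for x
  proof -
    have x: "x \<in> U" "x \<in> V" "q x \<in> T" "act (r x) a \<in> T" using that unfolding W_def by auto
    have "spin_cover M (q x) = spin_cover M (act (r x) a)"
      using Q(3)[OF x(1)] R(3)[OF x(2)] by (simp add: cover_act a cover_eq)
    then have "q x = act (r x) a" using inj x by (meson inj_onD)
    then have "sg (q x) * sg (r x) = sg (r x) * a * sg (r x)"
      using sg_act[of "r x" a] R(3)[OF x(2)] a by simp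
    also have "\<dots> = a" using Spin1_square[OF Sr[OF x(2)]] by (simp add: algebra_simps)
    finally show ?thesis unfolding q(2) r(2) a_def by (metis mult.commute of_real_mult)
  qed
  ultimately show ?thesis by blast
qed


subsection \<open>Functions twisted by local signs\<close>

text \<open>These are the coefficients, relative to \<open>base_spinor\<close>, of the smooth
  sections of the spinor bundle; \<open>smooth_section_spinor\<close> makes this precise for open
  \<open>U\<close>.\<close>

definition tsmooth :: "complex set \<Rightarrow> (complex \<Rightarrow> complex) \<Rightarrow> bool" where
  "tsmooth U f \<longleftrightarrow> (\<forall>V \<eta>. local_sign V \<eta> \<longrightarrow> smooth_fun_on (U \<inter> V) (\<lambda>z. \<eta> z * f z))"

text \<open>The choice of the local sign is immaterial, but only where the twisted function is differentiable;
  see \<open>tderiv_unique\<close>.\<close>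

definition tderiv :: "(complex \<Rightarrow> complex) \<Rightarrow> complex \<Rightarrow> complex" where
  "tderiv f z = (SOME d. \<exists>U \<eta>. local_sign U \<eta> \<and> z \<in> U \<and>
     d = \<eta> z * angular_deriv (\<lambda>x. \<eta> x * f x) z)"

lemma tsmoothD: "tsmooth U f \<Longrightarrow> local_sign V \<eta> \<Longrightarrow> smooth_fun_on (U \<inter> V) (\<lambda>z. \<eta> z * f z)"
  unfolding tsmooth_def by blast

lemma open_Int_sign: "open_in_S1 U \<Longrightarrow> local_sign V \<eta> \<Longrightarrow> open_in_S1 (U \<inter> V)"
  by (rule openin_Int[OF _ local_sign_open])

lemma tsmooth_cong:
  assumes "open_in_S1 U" "tsmooth U g" "\<And>x. x \<in> U \<Longrightarrow> f x = g x"
  shows "tsmooth U f"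
  unfolding tsmooth_def
proof (intro allI impI)
  fix V \<eta> assume V: "local_sign V \<eta>"
  show "smooth_fun_on (U \<inter> V) (\<lambda>z. \<eta> z * f z)"
    by (rule smooth_fun_on_cong[OF open_Int_sign[OF assms(1) V] tsmoothD[OF assms(2) V]])
      (use assms(3) in auto)
qed

text \<open>Passing from one sign to another multiplies the function near \<open>z\<close>, and
  hence its derivative, by the constant \<eta> z * \<theta> z. The outer sign in
  \<open>tderiv\<close> undoes this, so a derivative found with one sign determines every candidate
  of the choice.\<close>

lemma tderiv_unique:
  assumes U: "local_sign U \<eta>" "z \<in> U" and d: "has_angular_deriv (\<lambda>x. \<eta> x * f x) (\<eta> z * d) z"
  shows "tderiv f z = d"
proof -
  have eq: "\<theta> z * angular_deriv (\<lambda>x. \<theta> x * f x) z = d" if V: "local_sign V \<theta>" "z \<in> V" for V \<theta>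
  proof -
    obtain W where W: "open_in_S1 W" "z \<in> W" "W \<subseteq> U \<inter> V" "\<And>x. x \<in> W \<Longrightarrow> \<eta> x * \<theta> x = \<eta> z * \<theta> z"
      using local_sign_locally_constant[OF U(1) V(1) U(2) V(2)] by metis
    have \<theta>: "\<theta> x * f x = (\<eta> z * \<theta> z) * (\<eta> x * f x)" if x: "x \<in> W" for x
    proof -
      have "(\<eta> z * \<theta> z) * (\<eta> x * f x) = (\<eta> x * \<eta> x) * (\<theta> x * f x)"
        unfolding W(4)[OF x, symmetric] by (simp only: mult_ac)
      moreover have "\<eta> x * \<eta> x = 1" using local_sign_square[OF U(1)] W(3) x by blast
      ultimately show ?thesis by (metis mult_1_left)
    qed
    have "has_angular_deriv (\<lambda>x. (\<eta> z * \<theta> z) * (\<eta> x * f x)) (0 * (\<eta> z * f z) + (\<eta> z * \<theta> z) * (\<eta> z * d)) z"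
      by (rule has_angular_deriv_mult[OF has_angular_deriv_const d])
    then have "has_angular_deriv (\<lambda>x. \<theta> x * f x) (0 * (\<eta> z * f z) + (\<eta> z * \<theta> z) * (\<eta> z * d)) z"
      by (subst has_angular_deriv_cong[OF W(1,2) \<theta>])
    then have "angular_deriv (\<lambda>x. \<theta> x * f x) z = (\<eta> z * \<eta> z) * (\<theta> z * d)"
      by (auto dest: angular_deriv_eqI simp: algebra_simps)
    then have "\<theta> z * angular_deriv (\<lambda>x. \<theta> x * f x) z = (\<eta> z * \<eta> z) * (\<theta> z * \<theta> z) * d"
      by (simp add: algebra_simps)
    then show ?thesis using local_sign_square U V by simp
  qed
  show ?thesis
    unfolding tderiv_def
  proof (rule some_equality)
    show "\<exists>U \<eta>. local_sign U \<eta> \<and> z \<in> U \<and> d = \<eta> z * angular_deriv (\<lambda>x. \<eta> x * f x) z"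
      using eq[OF U] U by metis
  qed (use eq in blast)
qed

lemma has_angular_deriv_sign:
  assumes f: "tsmooth A f" and U: "local_sign U \<eta>" "z \<in> U" "z \<in> A"
  shows "has_angular_deriv (\<lambda>x. \<eta> x * f x) (\<eta> z * tderiv f z) z"
proof -
  have *: "has_angular_deriv (\<lambda>x. \<eta> x * f x) (angular_deriv (\<lambda>x. \<eta> x * f x) z) z"
    by (rule smooth_fun_onD[OF tsmoothD[OF f U(1)]]) (use U in auto)
  have e: "\<eta> z * (\<eta> z * angular_deriv (\<lambda>x. \<eta> x * f x) z) = angular_deriv (\<lambda>x. \<eta> x * f x) z"
    using local_sign_square[OF U(1,2)] by (simp flip: mult.assoc)
  have "tderiv f z = \<eta> z * angular_deriv (\<lambda>x. \<eta> x * f x) z"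
    by (rule tderiv_unique[OF U(1,2)]) (simp only: e *)
  then show ?thesis by (simp only: e *)
qed

lemma tderiv_eq:
  assumes "tsmooth A f" "local_sign U \<eta>" "z \<in> U" "z \<in> A"
  shows "\<eta> z * tderiv f z = angular_deriv (\<lambda>x. \<eta> x * f x) z"
  using angular_deriv_eqI[OF has_angular_deriv_sign[OF assms]] by simp

lemma tderiv_cong:
  assumes A: "open_in_S1 A" "z \<in> A" and f: "tsmooth A f" and eq: "\<And>x. x \<in> A \<Longrightarrow> g x = f x"
  shows "tderiv g z = tderiv f z"
proof -
  obtain U \<eta> where U: "local_sign U \<eta>" "z \<in> U"
    using local_sign_exists openin_imp_subset[OF A(1)] A(2) by blast
  have "has_angular_deriv (\<lambda>x. \<eta> x * g x) (\<eta> z * tderiv f z) z"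
    by (subst has_angular_deriv_cong[OF A, of _ "\<lambda>x. \<eta> x * f x"])
      (use eq has_angular_deriv_sign[OF f U A(2)] in auto)
  then show ?thesis by (rule tderiv_unique[OF U])
qed

section \<open>Calculus of twisted functions\<close>

lemma tsmooth_zero: "open_in_S1 U \<Longrightarrow> tsmooth U (\<lambda>z. 0)"
  unfolding tsmooth_def by (simp add: smooth_fun_on_const open_Int_sign)

lemma tsmooth_mult:
  assumes U: "open_in_S1 U" and c: "smooth_fun_on U c" and f: "tsmooth U f"
  shows "tsmooth U (\<lambda>z. c z * f z)"
  unfolding tsmooth_def
proof (intro allI impI)
  fix V \<eta> assume V: "local_sign V \<eta>"
  show "smooth_fun_on (U \<inter> V) (\<lambda>z. \<eta> z * (c z * f z))"
    unfolding mult.left_commute[of "\<eta> _"]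
    by (rule smooth_fun_on_mult[OF open_Int_sign[OF U V] smooth_fun_on_subset[OF c] tsmoothD[OF f V]]) auto
qed

text \<open>Signs are real, so they commute with conjugation. This lets Hermitian pairings be
  treated as products of twisted functions.\<close>

lemma tsmooth_cnj:
  assumes U: "open_in_S1 U" and f: "tsmooth U f"
  shows "tsmooth U (\<lambda>z. cnj (f z))"
  unfolding tsmooth_def
proof (intro allI impI)
  fix V \<eta> assume V: "local_sign V \<eta>"
  note O = open_Int_sign[OF U V]
  show "smooth_fun_on (U \<inter> V) (\<lambda>z. \<eta> z * cnj (f z))"
    by (rule smooth_fun_on_cong[OF O smooth_fun_on_cnj[OF O tsmoothD[OF f V]]])
      (use local_sign_real[OF V] in fastforce)
qed

lemma tsmooth_tderiv:
  assumes U: "open_in_S1 U" and f: "tsmooth U f"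
  shows "tsmooth U (tderiv f)"
  unfolding tsmooth_def
proof (intro allI impI)
  fix V \<eta> assume V: "local_sign V \<eta>"
  show "smooth_fun_on (U \<inter> V) (\<lambda>z. \<eta> z * tderiv f z)"
    by (rule smooth_fun_on_cong[OF open_Int_sign[OF U V] smooth_fun_on_angular_deriv[OF tsmoothD[OF f V]]])
      (use tderiv_eq[OF f V] in auto)
qed

text \<open>The analytic form of the triviality of the tensor square of the spinor bundle: inserting
  a local sign into both factors changes nothing, and makes each factor smooth.\<close>

lemma tsmooth_product:
  assumes U: "open_in_S1 U" and f: "tsmooth U f" and g: "tsmooth U g"
  shows "smooth_fun_on U (\<lambda>z. f z * g z)"
proof (rule smooth_fun_on_locally)
  fix z assume z: "z \<in> U"
  obtain V \<eta> where V: "local_sign V \<eta>" "z \<in> V"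
    using local_sign_exists openin_imp_subset[OF U] z by blast
  note O = open_Int_sign[OF U V(1)]
  have "f x * g x = (\<eta> x * f x) * (\<eta> x * g x)" if "x \<in> V" for x
    using local_sign_square[OF V(1) that] by (simp add: mult.left_commute mult.assoc[symmetric])
  then show "\<exists>W h. open_in_S1 W \<and> z \<in> W \<and> smooth_fun_on W h \<and> (\<forall>x\<in>W. f x * g x = h x)"
    using O z V(2) smooth_fun_on_mult[OF O tsmoothD[OF f V(1)] tsmoothD[OF g V(1)]]
    by (intro exI[of _ "U \<inter> V"] exI[of _ "\<lambda>x. (\<eta> x * f x) * (\<eta> x * g x)"]) auto
qed

lemma tderiv_add:
  assumes z: "open_in_S1 A" "z \<in> A" and f: "tsmooth A f" and g: "tsmooth A g"
  shows "tderiv (\<lambda>x. f x + g x) z = tderiv f z + tderiv g z"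
proof -
  obtain U \<eta> where U: "local_sign U \<eta>" "z \<in> U"
    using local_sign_exists openin_imp_subset[OF z(1)] z(2) by blast
  show ?thesis
    using has_angular_deriv_add[OF has_angular_deriv_sign[OF f U z(2)] has_angular_deriv_sign[OF g U z(2)]]
    by (intro tderiv_unique[OF U]) (simp add: ring_distribs)
qed

lemma tderiv_mult:
  assumes z: "open_in_S1 A" "z \<in> A" and c: "smooth_fun_on A c" and f: "tsmooth A f"
  shows "tderiv (\<lambda>x. c x * f x) z = angular_deriv c z * f z + c z * tderiv f z"
proof -
  obtain U \<eta> where U: "local_sign U \<eta>" "z \<in> U"
    using local_sign_exists openin_imp_subset[OF z(1)] z(2) by blast
  show ?thesis
    using has_angular_deriv_mult[OF smooth_fun_onD[OF c z(2)] has_angular_deriv_sign[OF f U z(2)]]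
    by (intro tderiv_unique[OF U]) (simp add: algebra_simps)
qed

lemma tderiv_cnj:
  assumes z: "open_in_S1 A" "z \<in> A" and f: "tsmooth A f"
  shows "tderiv (\<lambda>x. cnj (f x)) z = cnj (tderiv f z)"
proof -
  obtain U \<eta> where U: "local_sign U \<eta>" "z \<in> U"
    using local_sign_exists openin_imp_subset[OF z(1)] z(2) by blast
  have r: "cnj (\<eta> x) = \<eta> x" if "x \<in> U" for x using local_sign_real[OF U(1) that] by auto
  have "has_angular_deriv (\<lambda>x. cnj (\<eta> x * f x)) (\<eta> z * cnj (tderiv f z)) z"
    using has_angular_deriv_cnj[OF has_angular_deriv_sign[OF f U z(2)]] r[OF U(2)] by simp
  then have "has_angular_deriv (\<lambda>x. \<eta> x * cnj (f x)) (\<eta> z * cnj (tderiv f z)) z"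
    by (subst has_angular_deriv_cong[OF local_sign_open[OF U(1)] U(2), of _ "\<lambda>x. cnj (\<eta> x * f x)"])
      (use r in auto)
  then show ?thesis by (rule tderiv_unique[OF U])
qed

text \<open>The Leibniz rule from two twisted functions to an ordinary one. Both the compatibility
  of connection and metric and the formula for the tensor connection rest on it.\<close>

lemma has_angular_deriv_product:
  assumes z: "open_in_S1 A" "z \<in> A" and f: "tsmooth A f" and g: "tsmooth A g"
  shows "has_angular_deriv (\<lambda>x. f x * g x) (tderiv f z * g z + f z * tderiv g z) z"
proof -
  obtain U \<eta> where U: "local_sign U \<eta>" "z \<in> U"
    using local_sign_exists openin_imp_subset[OF z(1)] z(2) by blast
  have sq: "(\<eta> x * a) * (\<eta> x * b) = a * b" if "x \<in> U" for x a b
    using local_sign_square[OF U(1) that] by (simp add: mult.left_commute mult.assoc[symmetric])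
  have "has_angular_deriv (\<lambda>x. (\<eta> x * f x) * (\<eta> x * g x)) (tderiv f z * g z + f z * tderiv g z) z"
    using has_angular_deriv_mult[OF has_angular_deriv_sign[OF f U z(2)] has_angular_deriv_sign[OF g U z(2)]]
    by (simp add: sq[OF U(2)])
  then show ?thesis
    by (subst has_angular_deriv_cong[OF local_sign_open[OF U(1)] U(2), of _ "\<lambda>x. (\<eta> x * f x) * (\<eta> x * g x)"])
      (use sq in auto)
qed

lemma smooth_sign_product:
  assumes "local_sign U \<eta>" "local_sign V \<theta>"
  shows "smooth_fun_on (U \<inter> V) (\<lambda>z. \<eta> z * \<theta> z)"
proof (rule smooth_fun_on_locally)
  fix z assume z: "z \<in> U \<inter> V"
  then obtain W where W: "open_in_S1 W" "z \<in> W" "\<forall>x\<in>W. \<eta> x * \<theta> x = \<eta> z * \<theta> z"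
    using local_sign_locally_constant[OF assms] by blast
  then show "\<exists>W g. open_in_S1 W \<and> z \<in> W \<and> smooth_fun_on W g \<and> (\<forall>x\<in>W. \<eta> x * \<theta> x = g x)"
    using smooth_fun_on_const[OF W(1)] by blast
qed

lemma tsmooth_sign: "local_sign U \<eta> \<Longrightarrow> tsmooth U \<eta>"
  unfolding tsmooth_def
  by (subst mult.commute) (auto intro: smooth_sign_product)


subsection \<open>Sections and the connection of the spinor bundle\<close>

lemma spinor_frame_eq:
  assumes "local_spin_frame M V q" "z \<in> V"
  shows "spinor M (q z) w = scale_vec (of_real (sg (q z)) * w) (base_spinor z)"
  using spinor_eq_scale[of "q z" w] assms unfolding local_spin_frame_def by auto

text \<open>Evaluation at \<open>rep z\<close> extracts the coefficient, since
  \<open>base_spinor z\<close> has value 1 there. The coefficient in the frame [q, 1] differs from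
  it by the local sign, which is its own inverse.\<close>

lemma smooth_section_spinor:
  assumes U: "open_in_S1 U"
  shows "smooth_section_on (spinor_bundle M) U t \<longleftrightarrow>
    (\<forall>z\<in>U. t z = scale_vec (t z (rep z)) (base_spinor z)) \<and> tsmooth U (\<lambda>z. t z (rep z))"
proof (intro iffI conjI)
  note sub = openin_imp_subset[OF U]
  assume t: "smooth_section_on (spinor_bundle M) U t"
  then show eq: "\<forall>z\<in>U. t z = scale_vec (t z (rep z)) (base_spinor z)"
    using spinor_fibreD sub unfolding smooth_section_on_def by blast
  show "tsmooth U (\<lambda>z. t z (rep z))"
    unfolding tsmooth_def
  proof (intro allI impI)
    fix V \<eta> assume V: "local_sign V \<eta>"
    then obtain q where q: "local_spin_frame M V q" "\<eta> = (\<lambda>z. of_real (sg (q z)))"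
      unfolding local_sign_def by blast
    then have F: "(V, \<lambda>j z. spinor M (q z) 1) \<in> frames (spinor_bundle M)"
      unfolding spinor_bundle_def by auto
    obtain a where a: "\<forall>j<rk (spinor_bundle M). smooth_fun_on (U \<inter> V) (a j)"
        "\<forall>z\<in>U \<inter> V. t z = (\<Sum>j<rk (spinor_bundle M). scale_vec (a j z) (spinor M (q z) 1))"
      using bspec[OF conjunct2[OF t[unfolded smooth_section_on_def]] F] by auto
    have a0: "smooth_fun_on (U \<inter> V) (a (0::nat))"
      "\<And>z. z \<in> U \<inter> V \<Longrightarrow> t z = scale_vec (a 0 z) (spinor M (q z) 1)"
      using a by (auto simp: spinor_bundle_def)
    show "smooth_fun_on (U \<inter> V) (\<lambda>z. \<eta> z * t z (rep z))"
    proof (rule smooth_fun_on_cong[OF open_Int_sign[OF U V] a0(1)])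
      fix z assume z: "z \<in> U \<inter> V"
      have "t z (rep z) = a 0 z * \<eta> z"
        unfolding a0(2)[OF z] spinor_frame_eq[OF q(1) IntD2[OF z]]
        using z sub by (auto simp: scale_vec_apply base_spinor_rep q(2) subset_iff)
      then show "\<eta> z * t z (rep z) = a 0 z"
        using local_sign_square[OF V, of z] z by (simp add: mult.left_commute)
    qed
  qed
next
  note sub = openin_imp_subset[OF U]
  assume t: "(\<forall>z\<in>U. t z = scale_vec (t z (rep z)) (base_spinor z)) \<and> tsmooth U (\<lambda>z. t z (rep z))"
  show "smooth_section_on (spinor_bundle M) U t"
    unfolding smooth_section_on_def
  proof (intro conjI ballI)
    fix z assume "z \<in> U"
    then show "t z \<in> fibre (spinor_bundle M) z"
      using t sub by (subst spinor_fibre) blast+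
  next
    fix F assume "F \<in> frames (spinor_bundle M)"
    then obtain V q where q: "local_spin_frame M V q" "F = (V, \<lambda>j z. spinor M (q z) 1)"
      unfolding spinor_bundle_def by auto
    have V: "local_sign V (\<lambda>z. of_real (sg (q z)))" using q unfolding local_sign_def by blast
    have "t z = scale_vec (of_real (sg (q z)) * t z (rep z)) (spinor M (q z) 1)" if z: "z \<in> U \<inter> V" for z
    proof -
      have "scale_vec (of_real (sg (q z)) * t z (rep z)) (spinor M (q z) 1) =
          scale_vec ((of_real (sg (q z)) * of_real (sg (q z))) * t z (rep z)) (base_spinor z)"
        unfolding spinor_frame_eq[OF q(1) IntD2[OF z]] by (simp add: scale_vec_def mult_ac)
      also have "\<dots> = t z" using local_sign_square[OF V, of z] t z by auto
      finally show ?thesis by simp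
    qed
    then show "case F of (V, e) \<Rightarrow> \<exists>a. (\<forall>j<rk (spinor_bundle M). smooth_fun_on (U \<inter> V) (a j)) \<and>
        (\<forall>z\<in>U \<inter> V. t z = (\<Sum>j<rk (spinor_bundle M). scale_vec (a j z) (e j z)))"
      using tsmoothD[OF conjunct2[OF t] V] unfolding q(2)
      by (intro case_prodI exI[of _ "\<lambda>j z. of_real (sg (q z)) * t z (rep z)"])
        (auto simp: spinor_bundle_def)
  qed
qed

text \<open>The description in \<open>spinor_connection\<close> is legitimate because every spin
  frame gives this value: the coefficient \<open>t x (q x)\<close> is the sign times
  \<open>t x (rep x)\<close>, and \<open>tderiv\<close> does not see which sign is taken.\<close>

lemma spinor_connection_eq:
  assumes U: "open_in_S1 U" "z \<in> U" and t: "smooth_section_on (spinor_bundle M) U t"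
  shows "spinor_connection M t z v =
    scale_vec (of_real (tangent_coord z v) * tderiv (\<lambda>x. t x (rep x)) z) (base_spinor z)"
proof -
  have t1: "t x = scale_vec (t x (rep x)) (base_spinor x)" if "x \<in> U" for x
    using t that unfolding smooth_section_spinor[OF U(1)] by blast
  have t2: "tsmooth U (\<lambda>z. t z (rep z))"
    using t unfolding smooth_section_spinor[OF U(1)] by blast
  let ?r = "scale_vec (of_real (tangent_coord z v) * tderiv (\<lambda>x. t x (rep x)) z) (base_spinor z)"
  have *: "spinor M (q z) (dir_deriv (\<lambda>x. t x (q x)) z v) = ?r"
    if q: "local_spin_frame M V q" "z \<in> V" for V q
  proof -
    define \<eta> :: "complex \<Rightarrow> complex" where "\<eta> = (\<lambda>z. of_real (sg (q z)))"
    have V: "local_sign V \<eta>" using q unfolding local_sign_def \<eta>_def by blast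
    have "t x (q x) = \<eta> x * t x (rep x)" if x: "x \<in> U \<inter> V" for x
    proof -
      have "q x \<in> tot" "base_point M (q x) = x" using q x unfolding local_spin_frame_def by auto
      then have "base_spinor x (q x) = \<eta> x" using base_spinor_eq_sg[of "q x"] unfolding \<eta>_def by simp
      then show ?thesis using fun_cong[OF t1[of x], of "q x"] x by (simp add: scale_vec_apply)
    qed
    then have "angular_deriv (\<lambda>x. t x (q x)) z = angular_deriv (\<lambda>x. \<eta> x * t x (rep x)) z"
      using U q by (intro angular_deriv_cong[OF open_Int_sign[OF U(1) V]]) auto
    also have "\<dots> = \<eta> z * tderiv (\<lambda>x. t x (rep x)) z"
      by (rule tderiv_eq[OF t2 V q(2) U(2), symmetric])
    finally have "\<eta> z * angular_deriv (\<lambda>x. t x (q x)) z = tderiv (\<lambda>x. t x (rep x)) z"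
      using local_sign_square[OF V q(2)] by (simp flip: mult.assoc)
    then show ?thesis
      unfolding spinor_frame_eq[OF q] dir_deriv_def \<eta>_def by (simp add: mult.left_commute)
  qed
  obtain V q where q: "local_spin_frame M V q" "z \<in> V"
    using local_sign_exists openin_imp_subset[OF U(1)] U(2) unfolding local_sign_def by blast
  show ?thesis
    unfolding spinor_connection_def
  proof (rule the_equality)
    show "\<exists>U q. local_spin_frame M U q \<and> z \<in> U \<and> ?r = spinor M (q z) (dir_deriv (\<lambda>x. t x (q x)) z v)"
      using q *[OF q] by (intro exI[of _ V] exI[of _ q]) simp
  next
    fix y assume "\<exists>U q. local_spin_frame M U q \<and> z \<in> U \<and> y = spinor M (q z) (dir_deriv (\<lambda>x. t x (q x)) z v)"
    then obtain V q where "local_spin_frame M V q" "z \<in> V" "y = spinor M (q z) (dir_deriv (\<lambda>x. t x (q x)) z v)"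
      by (elim exE conjE)
    then show "y = ?r" using * by simp
  qed
qed

subsection \<open>The twisting bundle\<close>

definition delta :: "nat \<Rightarrow> nat \<Rightarrow> complex" where
  "delta j = (\<lambda>i. if i = j then 1 else 0)"

text \<open>This is the sum of \<open>k\<close> copies of the spinor bundle with its flat connection, the fibre of the
  spinor bundle over \<open>z\<close> being identified with \<open>complex\<close> by the vector \<open>base_spinor z\<close>. The function \<open>base_spinor\<close> is in
  general not continuous, but the ambient space plays no role in the topology of the bundle.\<close>

definition tw_bundle :: "nat \<Rightarrow> nat vbundle" where
  "tw_bundle k =
     \<lparr> rk = k,
       fibre = (\<lambda>z. {v. \<forall>i\<ge>k. v i = 0}),
       frames = {(V, \<lambda>j z. scale_vec (\<eta> z) (delta j)) | V \<eta>. local_sign V \<eta>} \<rparr>"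

definition tw_metric :: "nat \<Rightarrow> complex \<Rightarrow> (nat \<Rightarrow> complex) \<Rightarrow> (nat \<Rightarrow> complex) \<Rightarrow> complex" where
  "tw_metric k z u v = (\<Sum>i<k. u i * cnj (v i))"

text \<open>In each component this is the coefficient formula of
  \<open>spinor_connection_eq\<close>; the frames \<eta> z times \<open>delta j\<close> are
  parallel, as \<eta> has constant square.\<close>

definition tw_connection :: "nat covariant_deriv" where
  "tw_connection s z v = (\<lambda>i. of_real (tangent_coord z v) * tderiv (\<lambda>x. s x i) z)"

lemma sum_delta_apply:
  "(\<Sum>j<k. scale_vec (a j) (scale_vec c (delta j))) i = (if i < k then a i * c else 0)"
proof -
  have "(\<Sum>j<k. scale_vec (a j) (scale_vec c (delta j))) i = (\<Sum>j<k. if j = i then a i * c else 0)"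
    unfolding sum_fun_apply by (rule sum.cong) (auto simp: scale_vec_apply delta_def)
  then show ?thesis by simp
qed

lemma vector_bundle_tw: "vector_bundle (tw_bundle k)"
  unfolding vector_bundle_def
proof (intro conjI ballI)
  fix z assume "z \<in> S1"
  then show "\<exists>(U, e)\<in>frames (tw_bundle k). z \<in> U"
    using local_sign_exists[of z] unfolding tw_bundle_def by fastforce
next
  fix F assume "F \<in> frames (tw_bundle k)"
  then obtain V \<eta> where F: "F = (V, \<lambda>j z. scale_vec (\<eta> z) (delta j))" and V: "local_sign V \<eta>"
    unfolding tw_bundle_def by auto
  have "basis_of k (\<lambda>j. scale_vec (\<eta> z) (delta j)) {v. \<forall>i\<ge>k. v i = 0}" if z: "z \<in> V" for z
  proof -
    let ?b = "\<lambda>j. scale_vec (\<eta> z) (delta j)"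
    have nz: "\<eta> z \<noteq> 0" using local_sign_real[OF V z] by auto
    have zero: "u i = 0" if "(\<Sum>j\<in>{..<k}. scale_vec (u j) (?b j)) = 0" "i \<in> {..<k}" for u i
      using fun_cong[OF that(1), of i] that(2) nz by (simp add: sum_delta_apply del: cvec.scale_scale)
    have indep: "inj_on ?b {..<k}" "cvec.independent (?b ` {..<k})"
      by (rule cvec.independent_family, simp, rule zero, assumption+)+
    have "v \<in> cvec.span (?b ` {..<k}) \<longleftrightarrow> (\<forall>i\<ge>k. v i = 0)" for v
    proof -
      have "v \<in> cvec.span (?b ` {..<k}) \<longleftrightarrow> (\<exists>u. \<forall>i. v i = (if i < k then u i * \<eta> z else 0))"
        unfolding cvec.span_family[OF finite_lessThan indep(1)] fun_eq_iff sum_delta_apply by simp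
      also have "\<dots> \<longleftrightarrow> (\<forall>i\<ge>k. v i = 0)"
      proof
        assume "\<forall>i\<ge>k. v i = 0"
        then show "\<exists>u. \<forall>i. v i = (if i < k then u i * \<eta> z else 0)"
          using nz by (intro exI[of _ "\<lambda>i. v i / \<eta> z"]) simp
      qed fastforce
      finally show ?thesis .
    qed
    then show ?thesis using indep unfolding basis_of_def by blast
  qed
  then show "case F of (U, e) \<Rightarrow> open_in_S1 U \<and>
      (\<forall>z\<in>U. basis_of (rk (tw_bundle k)) (\<lambda>j. e j z) (fibre (tw_bundle k) z))"
    using local_sign_open[OF V] unfolding F by (simp add: tw_bundle_def)
next
  fix F assume "F \<in> frames (tw_bundle k)"
  then obtain V \<eta> where F: "F = (V, \<lambda>j z. scale_vec (\<eta> z) (delta j))" and V: "local_sign V \<eta>"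
    unfolding tw_bundle_def by auto
  show "case F of (U, e) \<Rightarrow> \<forall>(V, f)\<in>frames (tw_bundle k). \<exists>a.
        (\<forall>i<rk (tw_bundle k). \<forall>j<rk (tw_bundle k). smooth_fun_on (U \<inter> V) (a i j)) \<and>
        (\<forall>z\<in>U \<inter> V. \<forall>j<rk (tw_bundle k). f j z = (\<Sum>i<rk (tw_bundle k). scale_vec (a i j z) (e i z)))"
    unfolding F prod.case
  proof
    fix G assume "G \<in> frames (tw_bundle k)"
    then obtain W \<theta> where G: "G = (W, \<lambda>j z. scale_vec (\<theta> z) (delta j))" and W: "local_sign W \<theta>"
      unfolding tw_bundle_def by auto
    \<comment> \<open>Both frames are sign multiples of \<open>delta j\<close> and a sign is its own
      inverse, so the transition matrix is the scalar \<eta> z * \<theta> z, which is locally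
      constant.\<close>
    let ?a = "\<lambda>i j z. if i = j then \<eta> z * \<theta> z else 0"
    have "smooth_fun_on (V \<inter> W) (?a i j)" for i j :: nat
      using smooth_sign_product[OF V W] smooth_fun_on_const[OF open_Int_sign[OF local_sign_open[OF V] W]]
      by (cases "i = j") auto
    moreover have "scale_vec (\<theta> z) (delta j) = (\<Sum>i<k. scale_vec (?a i j z) (scale_vec (\<eta> z) (delta i)))"
      if z: "z \<in> V \<inter> W" and j: "j < k" for z j
    proof
      fix i
      show "scale_vec (\<theta> z) (delta j) i = (\<Sum>i<k. scale_vec (?a i j z) (scale_vec (\<eta> z) (delta i))) i"
        using local_sign_square[OF V, of z] z j
        unfolding sum_delta_apply by (auto simp: scale_vec_apply delta_def)
    qed
    ultimately show "case G of (U, f) \<Rightarrow> \<exists>a.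
        (\<forall>i<rk (tw_bundle k). \<forall>j<rk (tw_bundle k). smooth_fun_on (V \<inter> U) (a i j)) \<and>
        (\<forall>z\<in>V \<inter> U. \<forall>j<rk (tw_bundle k).
          f j z = (\<Sum>i<rk (tw_bundle k). scale_vec (a i j z) (scale_vec (\<eta> z) (delta i))))"
      unfolding G by (intro case_prodI exI[of _ ?a]) (simp add: tw_bundle_def del: cvec.scale_scale)
  qed
qed

text \<open>The counterpart of \<open>smooth_section_spinor\<close> for the twisting bundle; it
  reduces every later claim about the bundle to the calculus of twisted functions, component by
  component.\<close>

lemma smooth_section_tw:
  assumes U: "open_in_S1 U"
  shows "smooth_section_on (tw_bundle k) U s \<longleftrightarrow>
    (\<forall>z\<in>U. \<forall>i\<ge>k. s z i = 0) \<and> (\<forall>i. tsmooth U (\<lambda>z. s z i))"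
proof (intro iffI conjI)
  assume s: "smooth_section_on (tw_bundle k) U s"
  then show z: "\<forall>z\<in>U. \<forall>i\<ge>k. s z i = 0" by (simp add: smooth_section_on_def tw_bundle_def)
  show "\<forall>i. tsmooth U (\<lambda>z. s z i)"
  proof
    fix i
    show "tsmooth U (\<lambda>z. s z i)"
    proof (cases "i < k")
      case False
      then show ?thesis using z by (intro tsmooth_cong[OF U tsmooth_zero[OF U]]) auto
    next
      case True
      show ?thesis
        unfolding tsmooth_def
      proof (intro allI impI)
        fix V \<eta> assume V: "local_sign V \<eta>"
        then have F: "(V, \<lambda>j z. scale_vec (\<eta> z) (delta j)) \<in> frames (tw_bundle k)"
          unfolding tw_bundle_def by auto
        have "\<exists>a. (\<forall>j<rk (tw_bundle k). smooth_fun_on (U \<inter> V) (a j)) \<and>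
            (\<forall>z\<in>U \<inter> V. s z = (\<Sum>j<rk (tw_bundle k). scale_vec (a j z) (scale_vec (\<eta> z) (delta j))))"
          using bspec[OF conjunct2[OF s[unfolded smooth_section_on_def]] F] by simp
        then obtain a where a: "\<forall>j<k. smooth_fun_on (U \<inter> V) (a j)"
            "\<forall>z\<in>U \<inter> V. s z = (\<Sum>j<k. scale_vec (a j z) (scale_vec (\<eta> z) (delta j)))"
          unfolding tw_bundle_def by auto
        show "smooth_fun_on (U \<inter> V) (\<lambda>z. \<eta> z * s z i)"
        proof (rule smooth_fun_on_cong[OF open_Int_sign[OF U V]])
          show "smooth_fun_on (U \<inter> V) (a i)" using a True by simp
          fix z assume z: "z \<in> U \<inter> V"
          have "s z i = a i z * \<eta> z" using a(2) z True by (simp add: sum_delta_apply del: cvec.scale_scale)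
          then show "\<eta> z * s z i = a i z"
            using local_sign_square[OF V, of z] z by (simp add: mult.left_commute)
        qed
      qed
    qed
  qed
next
  assume s: "(\<forall>z\<in>U. \<forall>i\<ge>k. s z i = 0) \<and> (\<forall>i. tsmooth U (\<lambda>z. s z i))"
  show "smooth_section_on (tw_bundle k) U s"
    unfolding smooth_section_on_def
  proof (intro conjI ballI)
    fix z assume "z \<in> U"
    then show "s z \<in> fibre (tw_bundle k) z" using s by (simp add: tw_bundle_def)
  next
    fix F assume "F \<in> frames (tw_bundle k)"
    then obtain V \<eta> where F: "F = (V, \<lambda>j z. scale_vec (\<eta> z) (delta j))" and V: "local_sign V \<eta>"
      unfolding tw_bundle_def by auto
    have "s z = (\<Sum>j<k. scale_vec (\<eta> z * s z j) (scale_vec (\<eta> z) (delta j)))" if z: "z \<in> U \<inter> V" for z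
    proof
      fix i
      have "\<eta> z * s z i * \<eta> z = (\<eta> z * \<eta> z) * s z i" by (simp only: mult_ac)
      also have "\<dots> = s z i" using local_sign_square[OF V, of z] z by simp
      finally show "s z i = (\<Sum>j<k. scale_vec (\<eta> z * s z j) (scale_vec (\<eta> z) (delta j))) i"
        using z s by (simp only: sum_delta_apply) auto
    qed
    then show "case F of (V, e) \<Rightarrow> \<exists>a. (\<forall>j<rk (tw_bundle k). smooth_fun_on (U \<inter> V) (a j)) \<and>
        (\<forall>z\<in>U \<inter> V. s z = (\<Sum>j<rk (tw_bundle k). scale_vec (a j z) (e j z)))"
      unfolding F using tsmoothD[OF _ V] s
      by (intro case_prodI exI[of _ "\<lambda>j z. \<eta> z * s z j"]) (simp add: tw_bundle_def)
  qed
qed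

lemma hermitian_metric_tw: "hermitian_metric (tw_bundle k) (tw_metric k)"
  unfolding hermitian_metric_def
proof (intro conjI ballI allI impI)
  fix U s t
  assume U: "open_in_S1 U" and s: "smooth_section_on (tw_bundle k) U s"
    and t: "smooth_section_on (tw_bundle k) U t"
  have "smooth_fun_on U (\<lambda>z. s z i * cnj (t z i))" for i
    using s t unfolding smooth_section_tw[OF U] by (intro tsmooth_product[OF U] tsmooth_cnj[OF U]) auto
  then show "smooth_fun_on U (\<lambda>z. tw_metric k z (s z) (t z))"
    unfolding tw_metric_def by (intro smooth_fun_on_sum[OF U])
next
  fix z v assume v: "v \<in> fibre (tw_bundle k) z" "v \<noteq> 0"
  then obtain i where "v i \<noteq> 0" by (auto simp: fun_eq_iff)
  moreover from this have "i < k" using v by (auto simp: tw_bundle_def not_less[symmetric])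
  ultimately have "0 < (\<Sum>i<k. (norm (v i))\<^sup>2)" by (intro sum_pos2[of _ i]) auto
  also have "\<dots> = Re (tw_metric k z v v)"
    unfolding tw_metric_def complex_norm_square[symmetric] by simp
  finally show "Re (tw_metric k z v v) > 0" .
next
  fix z u v
  show "tw_metric k z u v = cnj (tw_metric k z v u)"
    unfolding tw_metric_def by (simp add: mult.commute)
next
  fix z u v w
  show "tw_metric k z (u + v) w = tw_metric k z u w + tw_metric k z v w"
    unfolding tw_metric_def by (simp add: ring_distribs sum.distrib)
next
  fix z u v c
  show "tw_metric k z (scale_vec c u) v = c * tw_metric k z u v"
    unfolding tw_metric_def by (simp add: scale_vec_apply sum_distrib_left mult.assoc)
qed

lemma connection_tw: "connection (tw_bundle k) tw_connection"
  unfolding connection_def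
proof (intro allI impI conjI ballI)
  fix U s assume U: "open_in_S1 U" and s: "smooth_section_on (tw_bundle k) U s"
  have s0: "\<And>z i. z \<in> U \<Longrightarrow> i \<ge> k \<Longrightarrow> s z i = 0" and s1: "\<And>i. tsmooth U (\<lambda>z. s z i)"
    using s unfolding smooth_section_tw[OF U] by auto
  {
    fix t z v assume "\<forall>z\<in>U. s z = t z" and z: "z \<in> U"
    then have "tderiv (\<lambda>x. t x i) z = tderiv (\<lambda>x. s x i) z" for i
      by (intro tderiv_cong[OF U z s1]) simp
    then show "tw_connection s z v = tw_connection t z v" unfolding tw_connection_def by simp
  next
    fix X assume X: "smooth_field_on U X"
    have "tderiv (\<lambda>x. s x i) z = 0" if "z \<in> U" "i \<ge> k" for z i
    proof -
      have "tderiv (\<lambda>x. s x i) z = tderiv (\<lambda>x. 0) z"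
        by (rule tderiv_cong[OF U that(1) tsmooth_zero[OF U]]) (use s0 that in auto)
      \<comment> \<open>The derivative of the zero function comes from the product rule with the
        constant factor 0, so that the choice inside \<open>tderiv\<close> is not opened
        again.\<close>
      also have "\<dots> = 0"
        using tderiv_mult[OF U that(1) smooth_fun_on_const[OF U] tsmooth_zero[OF U], of 0]
        by (simp add: angular_deriv_eqI[OF has_angular_deriv_const])
      finally show ?thesis .
    qed
    then show "smooth_section_on (tw_bundle k) U (\<lambda>z. tw_connection s z (X z))"
      unfolding smooth_section_tw[OF U] tw_connection_def
      by (auto intro!: tsmooth_mult[OF U] smooth_fun_on_tangent_coord[OF U X] tsmooth_tderiv[OF U s1])
  next
    fix z v w
    show "tw_connection s z (v + w) = tw_connection s z v + tw_connection s z w"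
      by (simp add: tw_connection_def tangent_coord_add fun_eq_iff ring_distribs)
  next
    fix z v and a :: real
    show "tw_connection s z (of_real a * v) = scale_vec (of_real a) (tw_connection s z v)"
      by (simp add: tw_connection_def tangent_coord_scale fun_eq_iff scale_vec_apply)
  next
    fix t z v assume t: "smooth_section_on (tw_bundle k) U t" and z: "z \<in> U"
    have "tsmooth U (\<lambda>z. t z i)" for i using t unfolding smooth_section_tw[OF U] by blast
    then show "tw_connection (\<lambda>x. s x + t x) z v = tw_connection s z v + tw_connection t z v"
      by (simp add: tw_connection_def fun_eq_iff tderiv_add[OF U z s1] ring_distribs)
  next
    fix f z v assume f: "smooth_fun_on U f" and z: "z \<in> U"
    show "tw_connection (\<lambda>x. scale_vec (f x) (s x)) z v =
        scale_vec (dir_deriv f z v) (s z) + scale_vec (f z) (tw_connection s z v)"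
      by (simp add: tw_connection_def fun_eq_iff scale_vec_apply tderiv_mult[OF U z f s1] dir_deriv_def
          algebra_simps)
  }
qed

lemma metric_connection_tw: "metric_connection (tw_bundle k) (tw_metric k) tw_connection"
  unfolding metric_connection_def
proof (intro conjI connection_tw allI impI ballI)
  fix U s t z v
  assume U: "open_in_S1 U" and s: "smooth_section_on (tw_bundle k) U s"
    and t: "smooth_section_on (tw_bundle k) U t" and z: "z \<in> U"
  have s1: "tsmooth U (\<lambda>z. s z i)" and t1: "tsmooth U (\<lambda>z. t z i)" for i
    using s t unfolding smooth_section_tw[OF U] by auto
  have "has_angular_deriv (\<lambda>x. tw_metric k x (s x) (t x))
      (\<Sum>i<k. tderiv (\<lambda>x. s x i) z * cnj (t z i) + s z i * tderiv (\<lambda>x. cnj (t x i)) z) z"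
    unfolding tw_metric_def
    by (intro has_angular_deriv_sum has_angular_deriv_product[OF U z s1 tsmooth_cnj[OF U t1]])
  then have "dir_deriv (\<lambda>x. tw_metric k x (s x) (t x)) z v = (\<Sum>i<k. of_real (tangent_coord z v) *
      (tderiv (\<lambda>x. s x i) z * cnj (t z i) + s z i * cnj (tderiv (\<lambda>x. t x i) z)))"
    unfolding dir_deriv_def by (simp only: angular_deriv_eqI sum_distrib_left tderiv_cnj[OF U z t1])
  also have "\<dots> = tw_metric k z (tw_connection s z v) (t z) + tw_metric k z (s z) (tw_connection t z v)"
    unfolding tw_metric_def tw_connection_def sum.distrib[symmetric]
    by (rule sum.cong) (simp_all add: algebra_simps)
  finally show "dir_deriv (\<lambda>x. tw_metric k x (s x) (t x)) z v =
      tw_metric k z (tw_connection s z v) (t z) + tw_metric k z (s z) (tw_connection t z v)" .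
qed


subsection \<open>The kernel of the twisted Dirac operator\<close>

abbreviation twisted :: "nat \<Rightarrow> (nat \<times> 'p) vbundle" where
  "twisted k \<equiv> twisted_spinor_bundle M (tw_bundle k)"

text \<open>The spinor bundle has rank one, so the index pair \<open>j div 1\<close>,
  \<open>j mod 1\<close> collapses to \<open>j\<close>, 0.\<close>

lemma twisted_frames:
  "frames (twisted k) = {(V \<inter> W, \<lambda>j z. tensor_vec (scale_vec (\<eta> z) (delta j)) (spinor M (q z) 1)) | V \<eta> W q.
    local_sign V \<eta> \<and> local_spin_frame M W q}"
proof (intro set_eqI)
  fix F
  have rk: "rk (spinor_bundle M) = 1" by (simp add: spinor_bundle_def)
  have 1: "F \<in> frames (twisted k) \<longleftrightarrow> (\<exists>V e W f. F = (V \<inter> W, \<lambda>j z. tensor_vec (e j z) (f 0 z)) \<and>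
      (V, e) \<in> frames (tw_bundle k) \<and> (W, f) \<in> frames (spinor_bundle M))"
    unfolding twisted_spinor_bundle_def tensor_bundle_def rk by simp
  have 2: "(V, e) \<in> frames (tw_bundle k) \<longleftrightarrow>
      (\<exists>\<eta>. e = (\<lambda>j z. scale_vec (\<eta> z) (delta j)) \<and> local_sign V \<eta>)" for V e
    by (simp add: tw_bundle_def)
  have 3: "(W, f) \<in> frames (spinor_bundle M) \<longleftrightarrow>
      (\<exists>q. f = (\<lambda>j z. spinor M (q z) 1) \<and> local_spin_frame M W q)" for W f
    by (simp add: spinor_bundle_def)
  show "F \<in> frames (twisted k) \<longleftrightarrow> F \<in> {(V \<inter> W, \<lambda>j z. tensor_vec (scale_vec (\<eta> z) (delta j)) (spinor M (q z) 1)) | V \<eta> W q.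
      local_sign V \<eta> \<and> local_spin_frame M W q}"
    unfolding 1 2 3 mem_Collect_eq
  proof (rule iffI; elim exE conjE)
    fix V \<eta> W q
    assume "F = (V \<inter> W, \<lambda>j z. tensor_vec (scale_vec (\<eta> z) (delta j)) (spinor M (q z) 1))"
      "local_sign V \<eta>" "local_spin_frame M W q"
    then show "\<exists>V e W f. F = (V \<inter> W, \<lambda>j z. tensor_vec (e j z) (f 0 z)) \<and>
        (\<exists>\<eta>. e = (\<lambda>j z. scale_vec (\<eta> z) (delta j)) \<and> local_sign V \<eta>) \<and>
        (\<exists>q. f = (\<lambda>j z. spinor M (q z) 1) \<and> local_spin_frame M W q)"
      by (intro exI[of _ V] exI[of _ "\<lambda>j z. scale_vec (\<eta> z) (delta j)"] exI[of _ W]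
          exI[of _ "\<lambda>j z. spinor M (q z) 1"] conjI exI[of _ \<eta>] exI[of _ q]) simp_all
  qed (hypsubst, intro exI conjI, rule refl, assumption, assumption)
qed

lemma twisted_rk: "rk (twisted k) = k"
  unfolding twisted_spinor_bundle_def tensor_bundle_def tw_bundle_def spinor_bundle_def by simp

lemma sum_tensor_delta_apply:
  "(\<Sum>j<k. scale_vec (a j) (tensor_vec (scale_vec c (delta j)) (scale_vec d w))) (i, p) =
    (if i < k then a i * (c * d) * w p else 0)"
proof -
  have "(\<Sum>j<k. scale_vec (a j) (tensor_vec (scale_vec c (delta j)) (scale_vec d w))) (i, p) =
      (\<Sum>j<k. if j = i then a i * (c * d) * w p else 0)"
    unfolding sum_fun_apply by (rule sum.cong) (auto simp: scale_vec_apply delta_def tensor_vec_def)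
  then show ?thesis by simp
qed

text \<open>Using the same spin frame for both factors, the frame vector is \<open>delta j\<close>
  tensor \<open>base_spinor x\<close> times the square of a sign. Hence the smooth coefficients in
  this frame are also the coefficients relative to the discontinuous reference spinor.\<close>

lemma twisted_section_coeffs:
  assumes \<psi>: "smooth_section_on (twisted k) S1 \<psi>" and z: "z \<in> S1"
  shows "\<exists>U a. open_in_S1 U \<and> z \<in> U \<and> (\<forall>i<k. smooth_fun_on U (a i)) \<and>
    (\<forall>x\<in>U. \<forall>i p. \<psi> x (i, p) = (if i < k then a i x * base_spinor x p else 0))"
proof -
  obtain V q where q: "local_spin_frame M V q" "z \<in> V"
    using local_sign_exists[OF z] unfolding local_sign_def by blast
  define \<eta> :: "complex \<Rightarrow> complex" where "\<eta> = (\<lambda>x. of_real (sg (q x)))"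
  have V: "local_sign V \<eta>" using q unfolding local_sign_def \<eta>_def by blast
  note O = local_sign_open[OF V] and sub = local_sign_sub[OF V]
  have F: "(V \<inter> V, \<lambda>j z. tensor_vec (scale_vec (\<eta> z) (delta j)) (spinor M (q z) 1)) \<in> frames (twisted k)"
    unfolding twisted_frames using V q(1) by blast
  obtain a where a: "\<forall>j<k. smooth_fun_on (S1 \<inter> (V \<inter> V)) (a j)"
      "\<forall>x\<in>S1 \<inter> (V \<inter> V). \<psi> x = (\<Sum>j<k. scale_vec (a j x) (tensor_vec (scale_vec (\<eta> x) (delta j)) (spinor M (q x) 1)))"
    using bspec[OF conjunct2[OF \<psi>[unfolded smooth_section_on_def twisted_rk]] F]
    unfolding prod.case by (elim exE conjE)
  have e: "S1 \<inter> (V \<inter> V) = V" using sub by blast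
  have "\<psi> x (i, p) = (if i < k then a i x * base_spinor x p else 0)" if x: "x \<in> V" for x i p
  proof -
    have "\<psi> x = (\<Sum>j<k. scale_vec (a j x) (tensor_vec (scale_vec (\<eta> x) (delta j)) (scale_vec (\<eta> x) (base_spinor x))))"
      using a(2) x unfolding e \<eta>_def spinor_frame_eq[OF q(1) x] by (simp del: cvec.scale_scale add: spinor_frame_eq[OF q(1) x])
    then show ?thesis
      by (simp only: sum_tensor_delta_apply local_sign_square[OF V x] mult_1_right)
  qed
  then show ?thesis using a(1) O q(2) unfolding e by blast
qed

lemma twisted_section_eq:
  assumes \<psi>: "smooth_section_on (twisted k) S1 \<psi>" and z: "z \<in> S1"
  shows "\<psi> z (i, p) = \<psi> z (i, rep z) * base_spinor z p"
  using twisted_section_coeffs[OF assms] base_spinor_rep[OF z] by auto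

lemma twisted_section_zero:
  assumes \<psi>: "smooth_section_on (twisted k) S1 \<psi>" and z: "z \<in> S1" and "i \<ge> k"
  shows "\<psi> z (i, p) = 0"
  using twisted_section_coeffs[OF assms(1,2)] assms(3) by auto

text \<open>Despite the evaluation at \<open>rep z\<close> these components are ordinary smooth
  functions on the whole circle: replacing \<open>rep z\<close> changes the sign in both tensor
  factors, and the changes cancel.\<close>

lemma twisted_section_smooth:
  assumes \<psi>: "smooth_section_on (twisted k) S1 \<psi>"
  shows "smooth_fun_on S1 (\<lambda>z. \<psi> z (i, rep z))"
proof (rule smooth_fun_on_locally)
  fix z :: complex assume z: "z \<in> S1"
  obtain U a where U: "open_in_S1 U" "z \<in> U" "\<forall>i<k. smooth_fun_on U (a i)"
    "\<forall>x\<in>U. \<forall>i p. \<psi> x (i, p) = (if i < k then a i x * base_spinor x p else 0)"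
    using twisted_section_coeffs[OF \<psi> z] by blast
  have "\<psi> x (i, rep x) = (if i < k then a i x else 0)" if "x \<in> U" for x
    using U(4) that base_spinor_rep[of x] openin_imp_subset[OF U(1)] by auto
  then show "\<exists>W g. open_in_S1 W \<and> z \<in> W \<and> smooth_fun_on W g \<and> (\<forall>x\<in>W. \<psi> x (i, rep x) = g x)"
    using U(1,2,3) smooth_fun_on_const[OF U(1), of 0]
    by (intro exI[of _ U] exI[of _ "\<lambda>x. if i < k then a i x else 0"]) (cases "i < k"; simp)
qed

text \<open>By the Leibniz rule the sum is the derivative of the components of \<psi>, an expression
  free of \<open>s\<close> and \<open>t\<close>. This gives the independence of the decomposition
  that the description in \<open>tensor_connection\<close> demands.\<close>

lemma tensor_connection_decomposition:
  fixes s :: "nat \<Rightarrow> nat bsection" and t :: "nat \<Rightarrow> 'p bsection"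
  assumes U: "open_in_S1 U" "z \<in> U"
    and s: "\<And>l. l < n \<Longrightarrow> smooth_section_on (tw_bundle k) U (s l)"
    and t: "\<And>l. l < n \<Longrightarrow> smooth_section_on (spinor_bundle M) U (t l)"
    and \<psi>: "\<And>x. x \<in> U \<Longrightarrow> \<psi> x = (\<Sum>l<n. tensor_vec (s l x) (t l x))"
  shows "(\<Sum>l<n. tensor_vec (tw_connection (s l) z v) (t l z) +
      tensor_vec (s l z) (spinor_connection M (t l) z v)) =
    (\<lambda>(i, p). of_real (tangent_coord z v) * angular_deriv (\<lambda>x. \<psi> x (i, rep x)) z * base_spinor z p)"
proof
  fix ip :: "nat \<times> 'p"
  obtain i p where ip: "ip = (i, p)" by (cases ip)
  let ?c = "of_real (tangent_coord z v) :: complex"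
  let ?t = "\<lambda>l x. t l x (rep x)"
  have s1: "tsmooth U (\<lambda>x. s l x i)" if "l < n" for l
    using s[OF that] unfolding smooth_section_tw[OF U(1)] by blast
  have t0: "t l z = scale_vec (?t l z) (base_spinor z)" and t1: "tsmooth U (?t l)" if "l < n" for l
    using t[OF that] U(2) unfolding smooth_section_spinor[OF U(1)] by blast+
  have "has_angular_deriv (\<lambda>x. \<Sum>l<n. s l x i * ?t l x)
      (\<Sum>l<n. tderiv (\<lambda>x. s l x i) z * ?t l z + s l z i * tderiv (?t l) z) z"
    by (intro has_angular_deriv_sum has_angular_deriv_product[OF U s1 t1]) auto
  then have "has_angular_deriv (\<lambda>x. \<psi> x (i, rep x))
      (\<Sum>l<n. tderiv (\<lambda>x. s l x i) z * ?t l z + s l z i * tderiv (?t l) z) z"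
    by (subst has_angular_deriv_cong[OF U, of _ "\<lambda>x. \<Sum>l<n. s l x i * ?t l x"])
      (simp_all add: \<psi> sum_fun_apply tensor_vec_def)
  then have d: "angular_deriv (\<lambda>x. \<psi> x (i, rep x)) z =
      (\<Sum>l<n. tderiv (\<lambda>x. s l x i) z * ?t l z + s l z i * tderiv (?t l) z)"
    by (rule angular_deriv_eqI)
  have "(tensor_vec (tw_connection (s l) z v) (t l z) +
      tensor_vec (s l z) (spinor_connection M (t l) z v)) (i, p) =
      ?c * (tderiv (\<lambda>x. s l x i) z * ?t l z + s l z i * tderiv (?t l) z) * base_spinor z p" if l: "l < n" for l
    using fun_cong[OF t0[OF l], of p]
    unfolding spinor_connection_eq[OF U t[OF l]]
    by (simp add: tensor_vec_def tw_connection_def scale_vec_apply algebra_simps)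
  then have "(\<Sum>l<n. tensor_vec (tw_connection (s l) z v) (t l z) +
      tensor_vec (s l z) (spinor_connection M (t l) z v)) (i, p) =
      (\<Sum>l<n. ?c * (tderiv (\<lambda>x. s l x i) z * ?t l z + s l z i * tderiv (?t l) z) * base_spinor z p)"
    unfolding sum_fun_apply by (intro sum.cong) auto
  also have "\<dots> = ?c * angular_deriv (\<lambda>x. \<psi> x (i, rep x)) z * base_spinor z p"
    unfolding d by (simp only: sum_distrib_left sum_distrib_right)
  finally show "(\<Sum>l<n. tensor_vec (tw_connection (s l) z v) (t l z) +
      tensor_vec (s l z) (spinor_connection M (t l) z v)) ip =
    (case ip of (i, p) \<Rightarrow> ?c * angular_deriv (\<lambda>x. \<psi> x (i, rep x)) z * base_spinor z p)"
    unfolding ip by simp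
qed

lemma tensor_connection_eq:
  assumes \<psi>: "smooth_section_on (twisted k) S1 \<psi>" and z: "z \<in> S1"
  shows "tensor_connection (tw_bundle k) tw_connection (spinor_bundle M) (spinor_connection M) \<psi> z v =
    (\<lambda>(i, p). of_real (tangent_coord z v) * angular_deriv (\<lambda>x. \<psi> x (i, rep x)) z * base_spinor z p)"
    (is "_ = ?rhs")
  unfolding tensor_connection_def
proof (rule the_equality)
  obtain V \<eta> where V: "local_sign V \<eta>" "z \<in> V" using local_sign_exists[OF z] by blast
  note O = local_sign_open[OF V(1)] and sub = local_sign_sub[OF V(1)]
  \<comment> \<open>The coefficient is an ordinary smooth function, while both factors need twisted
    ones. A sign is put into each factor, and the two cancel in the tensor product.\<close>
  define s where "s l x = scale_vec (\<psi> x (l, rep x) * \<eta> x) (delta l)" for l x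
  define t where "t x = scale_vec (\<eta> x) (base_spinor x)" for x
  have s: "smooth_section_on (tw_bundle k) V (s l)" if l: "l < k" for l
    unfolding smooth_section_tw[OF O]
  proof (intro conjI ballI allI impI)
    fix x i assume "k \<le> i"
    then show "s l x i = 0" using l by (simp add: s_def scale_vec_apply delta_def)
  next
    fix i
    have "tsmooth V (\<lambda>x. \<psi> x (l, rep x) * \<eta> x)"
      by (rule tsmooth_mult[OF O smooth_fun_on_subset[OF twisted_section_smooth[OF \<psi>] sub] tsmooth_sign[OF V(1)]])
    then show "tsmooth V (\<lambda>x. s l x i)"
      using tsmooth_zero[OF O] by (cases "i = l") (simp_all add: s_def scale_vec_apply delta_def)
  qed
  have trep: "t x (rep x) = \<eta> x" if "x \<in> V" for x
    using base_spinor_rep sub that by (auto simp: t_def scale_vec_apply)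
  have t: "smooth_section_on (spinor_bundle M) V t"
    unfolding smooth_section_spinor[OF O]
    using trep tsmooth_cong[OF O tsmooth_sign[OF V(1)], of "\<lambda>x. t x (rep x)"] by (simp add: t_def)
  have dec: "\<psi> x = (\<Sum>l<k. tensor_vec (s l x) (t x))" if x: "x \<in> V" for x
  proof
    fix ip :: "nat \<times> 'p"
    obtain i p where ip: "ip = (i, p)" by (cases ip)
    have xS: "x \<in> S1" using x sub by blast
    have "(\<Sum>l<k. tensor_vec (s l x) (t x)) (i, p) =
        (\<Sum>l<k. if l = i then \<psi> x (i, rep x) * (\<eta> x * \<eta> x) * base_spinor x p else 0)"
      unfolding sum_fun_apply
      by (rule sum.cong) (auto simp: s_def t_def tensor_vec_def scale_vec_apply delta_def)
    also have "\<dots> = (if i < k then \<psi> x (i, rep x) * base_spinor x p else 0)"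
      by (simp add: local_sign_square[OF V(1) x])
    also have "\<dots> = \<psi> x (i, p)"
      using twisted_section_eq[OF \<psi> xS, of i p] twisted_section_zero[OF \<psi> xS, of i] by simp
    finally show "\<psi> x ip = (\<Sum>l<k. tensor_vec (s l x) (t x)) ip" unfolding ip by simp
  qed
  have eq: "(\<Sum>l<k. tensor_vec (tw_connection (s l) z v) (t z) +
      tensor_vec (s l z) (spinor_connection M t z v)) = ?rhs"
    by (rule tensor_connection_decomposition[OF O V(2) s t dec])
  show "\<exists>U n s t. open_in_S1 U \<and> z \<in> U \<and>
      (\<forall>l<n::nat. smooth_section_on (tw_bundle k) U (s l) \<and> smooth_section_on (spinor_bundle M) U (t l)) \<and>
      (\<forall>x\<in>U. \<psi> x = (\<Sum>l<n. tensor_vec (s l x) (t l x))) \<and>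
      ?rhs = (\<Sum>l<n. tensor_vec (tw_connection (s l) z v) (t l z) +
        tensor_vec (s l z) (spinor_connection M (t l) z v))"
  proof (rule exI[of _ V], rule exI[of _ k], rule exI[of _ s], rule exI[of _ "\<lambda>l. t"],
      intro conjI allI impI ballI)
    show "?rhs = (\<Sum>l<k. tensor_vec (tw_connection (s l) z v) (t z) +
        tensor_vec (s l z) (spinor_connection M t z v))"
      by (rule eq[symmetric])
  qed (rule O V(2) s t dec; assumption?)+
next
  fix y
  assume "\<exists>U n s t. open_in_S1 U \<and> z \<in> U \<and>
      (\<forall>l<n::nat. smooth_section_on (tw_bundle k) U (s l) \<and> smooth_section_on (spinor_bundle M) U (t l)) \<and>
      (\<forall>x\<in>U. \<psi> x = (\<Sum>l<n. tensor_vec (s l x) (t l x))) \<and>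
      y = (\<Sum>l<n. tensor_vec (tw_connection (s l) z v) (t l z) +
        tensor_vec (s l z) (spinor_connection M (t l) z v))"
  then obtain U n s t where *: "open_in_S1 U" "z \<in> U"
      "\<forall>l<n::nat. smooth_section_on (tw_bundle k) U (s l) \<and> smooth_section_on (spinor_bundle M) U (t l)"
      "\<forall>x\<in>U. \<psi> x = (\<Sum>l<n. tensor_vec (s l x) (t l x))"
      "y = (\<Sum>l<n. tensor_vec (tw_connection (s l) z v) (t l z) +
        tensor_vec (s l z) (spinor_connection M (t l) z v))"
    by (elim exE conjE)
  show "y = ?rhs"
    unfolding *(5) by (rule tensor_connection_decomposition[OF *(1,2)]) (use *(3,4) in auto)
qed

text \<open>The Clifford action contributes just the imaginary unit because the tangent vector has
  length 1. In this trivialisation the operator is differentiation along the circle up to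
  nonvanishing factors.\<close>

lemma twisted_dirac_eq:
  assumes \<psi>: "smooth_section_on (twisted k) S1 \<psi>" and z: "z \<in> S1"
  shows "twisted_dirac M (tw_bundle k) tw_connection \<psi> z = (\<lambda>(i, p).
    \<i> * (of_real (tangent_coord z (unit_tangent M z)) * angular_deriv (\<lambda>x. \<psi> x (i, rep x)) z * base_spinor z p))"
  unfolding twisted_dirac_def tensor_connection_eq[OF assms] twisted_clifford_def clifford_def
    riem_unit_tangent[OF z]
  by (simp add: scale_vec_def)

section \<open>Parallel spinors and the dimension of the kernel\<close>

definition parallel_section :: "(nat \<Rightarrow> complex) \<Rightarrow> (nat \<times> 'p) bsection" where
  "parallel_section C = (\<lambda>z. if z \<in> S1 then tensor_vec C (base_spinor z) else 0)"

text \<open>In the frame given by signs \<eta> and \<theta> the coefficient is \<open>C j\<close>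
  times \<eta> \<theta>: the frame carries that same factor, which squares to 1, and the product of
  two signs is locally constant.\<close>

lemma parallel_section_smooth:
  assumes C: "\<forall>i\<ge>k. C i = 0"
  shows "smooth_section_on (twisted k) S1 (parallel_section C)"
  unfolding smooth_section_on_def
proof (intro conjI ballI)
  fix z :: complex assume z: "z \<in> S1"
  have "base_spinor z \<in> fibre (spinor_bundle M) z"
    unfolding spinor_fibre[OF z] by (auto intro!: image_eqI[of _ _ 1])
  moreover have "C \<in> fibre (tw_bundle k) z" using C by (simp add: tw_bundle_def)
  ultimately show "parallel_section C z \<in> fibre (twisted k) z"
    using z unfolding twisted_spinor_bundle_def tensor_bundle_def parallel_section_def
    by (auto intro!: cvec.span_base)
next
  fix F assume "F \<in> frames (twisted k)"
  then obtain V \<eta> W q where F: "F = (V \<inter> W, \<lambda>j z. tensor_vec (scale_vec (\<eta> z) (delta j)) (spinor M (q z) 1))"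
    and V: "local_sign V \<eta>" and q: "local_spin_frame M W q"
    unfolding twisted_frames by blast
  define \<theta> :: "complex \<Rightarrow> complex" where "\<theta> = (\<lambda>x. of_real (sg (q x)))"
  have W: "local_sign W \<theta>" using q unfolding local_sign_def \<theta>_def by blast
  note O = open_Int_sign[OF local_sign_open[OF V] W]
  have sub: "S1 \<inter> (V \<inter> W) = V \<inter> W" using local_sign_sub[OF V] by blast
  have "parallel_section C x = (\<Sum>j<k. scale_vec (C j * (\<eta> x * \<theta> x))
      (tensor_vec (scale_vec (\<eta> x) (delta j)) (spinor M (q x) 1)))" if x: "x \<in> V \<inter> W" for x
  proof
    fix ip :: "nat \<times> 'p"
    obtain i p where ip: "ip = (i, p)" by (cases ip)
    have sp: "spinor M (q x) 1 = scale_vec (\<theta> x) (base_spinor x)"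
      using spinor_frame_eq[OF q, of x 1] x unfolding \<theta>_def by simp
    have "(C i * (\<eta> x * \<theta> x)) * (\<eta> x * \<theta> x) = C i * (\<eta> x * \<eta> x) * (\<theta> x * \<theta> x)" by (simp only: mult_ac)
    also have "\<dots> = C i"
      by (simp only: local_sign_square[OF V IntD1[OF x]] local_sign_square[OF W IntD2[OF x]] mult_1_right)
    finally have "(C i * (\<eta> x * \<theta> x)) * (\<eta> x * \<theta> x) = C i" .
    moreover have "x \<in> S1" using x sub by blast
    ultimately show "parallel_section C x ip = (\<Sum>j<k. scale_vec (C j * (\<eta> x * \<theta> x))
      (tensor_vec (scale_vec (\<eta> x) (delta j)) (spinor M (q x) 1))) ip"
      unfolding ip sp sum_tensor_delta_apply parallel_section_def
      using C by (auto simp: tensor_vec_def not_less)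
  qed
  moreover have "smooth_fun_on (V \<inter> W) (\<lambda>x. C j * (\<eta> x * \<theta> x))" for j
    by (rule smooth_fun_on_mult[OF O smooth_fun_on_const[OF O] smooth_sign_product[OF V W]])
  ultimately show "case F of (V, e) \<Rightarrow> \<exists>a. (\<forall>j<rk (twisted k). smooth_fun_on (S1 \<inter> V) (a j)) \<and>
      (\<forall>z\<in>S1 \<inter> V. parallel_section C z = (\<Sum>j<rk (twisted k). scale_vec (a j z) (e j z)))"
    unfolding F prod.case twisted_rk sub
    by (intro exI[of _ "\<lambda>j x. C j * (\<eta> x * \<theta> x)"]) simp
qed

lemma parallel_section_rep: "z \<in> S1 \<Longrightarrow> parallel_section C z (i, rep z) = C i"
  by (simp add: parallel_section_def tensor_vec_def base_spinor_rep)

lemma dirac_kernel_eq: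
  "dirac_kernel M (tw_bundle k) tw_connection = parallel_section ` {C. \<forall>i\<ge>k. C i = 0}"
proof (intro set_eqI iffI)
  fix \<psi> assume "\<psi> \<in> dirac_kernel M (tw_bundle k) tw_connection"
  then have \<psi>: "smooth_section_on (twisted k) S1 \<psi>" and out: "\<And>z. z \<notin> S1 \<Longrightarrow> \<psi> z = 0"
    and D: "\<And>z. z \<in> S1 \<Longrightarrow> twisted_dirac M (tw_bundle k) tw_connection \<psi> z = 0"
    unfolding dirac_kernel_def by blast+
  define C where "C i = \<psi> 1 (i, rep 1)" for i
  have "\<psi> z (i, rep z) = C i" if z: "z \<in> S1" for z i
    unfolding C_def
  proof (rule angular_deriv_zero_imp_constant[OF twisted_section_smooth[OF \<psi>] _ z])
    fix x :: complex assume x: "x \<in> S1"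
    \<comment> \<open>At \<open>rep x\<close> the reference spinor is 1 and the coordinate of the
      unit tangent is nonzero, so the vanishing of the operator leaves only the derivative.\<close>
    show "angular_deriv (\<lambda>x. \<psi> x (i, rep x)) x = 0"
      using fun_cong[OF D[OF x], of "(i, rep x)"] base_spinor_rep[OF x] tangent_coord_unit_tangent[OF x]
      unfolding twisted_dirac_eq[OF \<psi> x] by simp
  qed
  then have "\<psi> z (i, p) = parallel_section C z (i, p)" for z i p
    using twisted_section_eq[OF \<psi>, of z i p] out[of z]
    by (cases "z \<in> S1") (simp_all add: parallel_section_def tensor_vec_def)
  then have "\<psi> = parallel_section C" by (auto simp: fun_eq_iff)
  moreover have "\<forall>i\<ge>k. C i = 0" using twisted_section_zero[OF \<psi>, of 1] by (simp add: C_def)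
  ultimately show "\<psi> \<in> parallel_section ` {C. \<forall>i\<ge>k. C i = 0}" by blast
next
  fix \<psi> assume "\<psi> \<in> parallel_section ` {C. \<forall>i\<ge>k. C i = 0}"
  then obtain C where C: "\<forall>i\<ge>k. C i = 0" and \<psi>: "\<psi> = parallel_section C" by blast
  note sm = parallel_section_smooth[OF C]
  have "angular_deriv (\<lambda>x. parallel_section C x (i, rep x)) z = 0" if z: "z \<in> S1" for i z
    using angular_deriv_cong[OF openin_subtopology_self z, of "\<lambda>x. parallel_section C x (i, rep x)" "\<lambda>x. C i"]
      parallel_section_rep angular_deriv_eqI[OF has_angular_deriv_const] by simp
  then have "twisted_dirac M (tw_bundle k) tw_connection \<psi> z = 0" if "z \<in> S1" for z
    unfolding \<psi> twisted_dirac_eq[OF sm that] using that by (auto simp: fun_eq_iff)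
  then show "\<psi> \<in> dirac_kernel M (tw_bundle k) tw_connection"
    unfolding dirac_kernel_def using sm by (simp add: \<psi> parallel_section_def)
qed

lemma sum_parallel_section_apply:
  "(\<Sum>j<k. scale_sec (u j) (parallel_section (delta j))) z (i, p) =
    (if z \<in> S1 \<and> i < k then u i * base_spinor z p else 0)"
proof -
  have "(\<Sum>j<k. scale_sec (u j) (parallel_section (delta j))) z (i, p) =
      (\<Sum>j<k. if j = i then (if z \<in> S1 then u i * base_spinor z p else 0) else 0)"
    unfolding sum_fun_apply
    by (rule sum.cong) (auto simp: scale_sec_def scale_vec_apply parallel_section_def tensor_vec_def delta_def)
  then show ?thesis by simp
qed

lemma dim_dirac_kernel: "csec.dim (dirac_kernel M (tw_bundle k) tw_connection) = k"
proof (rule csec.dim_unique)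
  let ?b = "\<lambda>j. parallel_section (delta j)"
  \<comment> \<open>Evaluation at the point 1 and the index \<open>(i, rep 1)\<close> isolates the
    coefficient \<open>u i\<close>.\<close>
  have zero: "u i = 0" if "(\<Sum>j\<in>{..<k}. scale_sec (u j) (?b j)) = 0" "i \<in> {..<k}" for u i
    using fun_cong[OF fun_cong[OF that(1), of 1], of "(i, rep 1)"] that(2)
    unfolding sum_parallel_section_apply by (simp add: base_spinor_rep)
  have indep: "inj_on ?b {..<k}" "csec.independent (?b ` {..<k})"
    by (rule csec.independent_family, simp, rule zero, assumption+)+
  show "csec.independent (?b ` {..<k})" by (rule indep)
  show "card (?b ` {..<k}) = k" by (simp add: card_image indep)
  show "?b ` {..<k} \<subseteq> dirac_kernel M (tw_bundle k) tw_connection"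
    unfolding dirac_kernel_eq by (auto simp: delta_def)
  show "dirac_kernel M (tw_bundle k) tw_connection \<subseteq> csec.span (?b ` {..<k})"
  proof
    fix \<psi> assume "\<psi> \<in> dirac_kernel M (tw_bundle k) tw_connection"
    then obtain C where C: "\<forall>i\<ge>k. C i = 0" "\<psi> = parallel_section C"
      unfolding dirac_kernel_eq by blast
    have "\<psi> z (i, p) = (\<Sum>j<k. scale_sec (C j) (?b j)) z (i, p)" for z i p
      unfolding sum_parallel_section_apply C(2) using C(1)
      by (auto simp: parallel_section_def tensor_vec_def not_less)
    then have "\<psi> = (\<Sum>j<k. scale_sec (C j) (?b j))" by (intro ext) auto
    then show "\<psi> \<in> csec.span (?b ` {..<k})"
      unfolding csec.span_family[OF finite_lessThan indep(1)] by blast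
  qed
qed

end

theorem lemma1p2:
  fixes k :: nat and M :: "('p::topological_space) spin_circle"
  assumes "k > 0" and "riemannian_spin_circle M"
  shows "\<exists>(E :: nat vbundle) h nab.
           vector_bundle E \<and> hermitian_metric E h \<and> metric_connection E h nab \<and>
           csec.dim (dirac_kernel M E nab) \<ge> k"
proof -
  interpret spin_circle_context M by unfold_locales (rule assms)
  show ?thesis
    using vector_bundle_tw hermitian_metric_tw metric_connection_tw dim_dirac_kernel by (metis order_refl)
qed

end
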